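(* There are no extremal semi-parallel spacelike hypersurfaces in the Einstein-de Sitter spacetime $\mathcal{E}^{n+1}$.
   Context: $\mathcal{E}^{n+1}$ is the $(n+1)$-dimensional Einstein-de Sitter spacetime: the Lorentzian warped product $(0,\infty)\times_{t^{1/3}}\mathbb{R}^n$, i.e. $(0,\infty)\times\mathbb{R}^n$ with metric $-dt^2+t^{2/3}g_{\mathbb{R}^n}$, where $g_{\mathbb{R}^n}$ is the Euclidean metric. A hypersurface $M^n$ is spacelike if its induced metric is positive definite. $\alpha$ is the second fundamental form; the hypersurface is extremal if its mean curvature vector field $\vec H=\frac1n\mathrm{tr}(\alpha)$ vanishes identically. It is semi-parallel if $(\overline R(X,Y)\cdot\alpha)(Z,W)=0$ for all tangent $X,Y,Z,W$, where $(\overline R(X,Y)\cdot\alpha)(Z,W)=R^\perp(X,Y)\alpha(Z,W)-\alpha(R(X,Y)Z,W)-\alpha(Z,R(X,Y)W)$ with $R,R^\perp$ the curvature tensors of $TM$ and $TM^\perp$.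
   Formalization: The formal theorem assumes n ≥ 2; for n = 1 the claim fails, since any spacelike geodesic of the 2-dimensional Einstein-de Sitter spacetime is an extremal, trivially semi-parallel spacelike hypersurface. *)

theory Defs
  imports "HOL-Analysis.Analysis"
begin

section \<open>Smooth maps and smooth manifolds\<close>

abbreviation ddir :: "('a::euclidean_space \<Rightarrow> 'b::real_normed_vector) \<Rightarrow> 'a \<Rightarrow> 'a \<Rightarrow> 'b" where
  "ddir f p v \<equiv> frechet_derivative f (at p) v"

text \<open>The following two notions are meant for open sets \<open>S\<close>.\<close>

primrec Ck_on :: "nat \<Rightarrow> 'a set \<Rightarrow> ('a::euclidean_space \<Rightarrow> 'b::real_normed_vector) \<Rightarrow> bool" where
  "Ck_on 0 S f \<longleftrightarrow> continuous_on S f"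
| "Ck_on (Suc k) S f \<longleftrightarrow>
     (\<forall>p\<in>S. f differentiable (at p)) \<and> (\<forall>v. Ck_on k S (\<lambda>p. ddir f p v))"

definition smooth_on :: "'a set \<Rightarrow> ('a::euclidean_space \<Rightarrow> 'b::real_normed_vector) \<Rightarrow> bool" where
  "smooth_on S f \<longleftrightarrow> (\<forall>k. Ck_on k S f)"

text \<open>A chart is a pair of a domain and a coordinate map; the values of the coordinate map
  outside its domain are irrelevant.\<close>

type_synonym ('m, 'n) chart = "'m set \<times> ('m \<Rightarrow> real ^ 'n)"

definition smooth_manifold :: "'m topology \<Rightarrow> ('m, 'n::finite) chart set \<Rightarrow> bool" where
  "smooth_manifold M \<A> \<longleftrightarrow>
     Hausdorff_space M \<and> second_countable M \<and>
     (\<Union>(U, \<phi>)\<in>\<A>. U) = topspace M \<and>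
     (\<forall>(U, \<phi>)\<in>\<A>. openin M U \<and> open (\<phi> ` U) \<and>
        homeomorphic_map (subtopology M U) (top_of_set (\<phi> ` U)) \<phi>) \<and>
     (\<forall>(U, \<phi>)\<in>\<A>. \<forall>(V, \<psi>)\<in>\<A>. smooth_on (\<phi> ` (U \<inter> V)) (\<psi> \<circ> inv_into U \<phi>))"

definition immersion ::
    "('m, 'n::finite) chart set \<Rightarrow> ('m \<Rightarrow> 'e::euclidean_space) \<Rightarrow> bool" where
  "immersion \<A> F \<longleftrightarrow>
     (\<forall>(U, \<phi>)\<in>\<A>. smooth_on (\<phi> ` U) (F \<circ> inv_into U \<phi>) \<and>
        (\<forall>p\<in>\<phi> ` U. inj (ddir (F \<circ> inv_into U \<phi>) p)))"

section \<open>Semi-Riemannian metrics on open sets of a Euclidean space\<close>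

text \<open>A metric assigns to each point a bilinear form on the tangent space, which is identified
  with the ambient vector space.\<close>

type_synonym 'a metric = "'a \<Rightarrow> 'a \<Rightarrow> 'a \<Rightarrow> real"

text \<open>The Levi-Civita covariant derivative of the constant vector field \<open>v\<close> in the direction \<open>u\<close>,
  determined by the Koszul formula for constant (hence commuting) vector fields.\<close>

definition christoffel :: "('a::euclidean_space) metric \<Rightarrow> 'a \<Rightarrow> 'a \<Rightarrow> 'a \<Rightarrow> 'a" where
  "christoffel g p u v =
     (THE w. \<forall>z. 2 * g p w z =
        ddir (\<lambda>q. g q v z) p u + ddir (\<lambda>q. g q u z) p v - ddir (\<lambda>q. g q u v) p z)"

definition cov_deriv :: "('a::euclidean_space) metric \<Rightarrow> 'a \<Rightarrow> 'a \<Rightarrow> ('a \<Rightarrow> 'a) \<Rightarrow> 'a" where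
  "cov_deriv g p u Y = ddir Y p u + christoffel g p u (Y p)"

text \<open>\<open>R(u,v)w\<close> with \<open>R(X,Y) = [\<nabla>\<^sub>X, \<nabla>\<^sub>Y] - \<nabla>\<^bsub>[X,Y]\<^esub>\<close>; the vectors are extended to constant fields, so
  that the bracket term vanishes. By tensoriality the choice of extension is immaterial.\<close>

definition riemann :: "('a::euclidean_space) metric \<Rightarrow> 'a \<Rightarrow> 'a \<Rightarrow> 'a \<Rightarrow> 'a \<Rightarrow> 'a" where
  "riemann g p u v w =
     cov_deriv g p u (\<lambda>q. cov_deriv g q v (\<lambda>_. w)) -
     cov_deriv g p v (\<lambda>q. cov_deriv g q u (\<lambda>_. w))"

section \<open>Geometry of a parametrised submanifold\<close>

text \<open>Here \<open>f\<close> is a local parametrisation, i.e. an immersion of an open subset of \<open>\<real>\<^sup>n\<close> into a space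
  with metric \<open>g\<close>. Tangent vectors of the submanifold are given by their coordinate vectors \<open>u\<close>,
  corresponding to \<open>ddir f p u\<close> in the ambient space.\<close>

definition induced_metric ::
    "('e::euclidean_space) metric \<Rightarrow> ('a::euclidean_space \<Rightarrow> 'e) \<Rightarrow> 'a metric" where
  "induced_metric g f p u v = g (f p) (ddir f p u) (ddir f p v)"

definition cov_along ::
    "('e::euclidean_space) metric \<Rightarrow> ('a::euclidean_space \<Rightarrow> 'e) \<Rightarrow> 'a \<Rightarrow> 'a \<Rightarrow> ('a \<Rightarrow> 'e) \<Rightarrow> 'e" where
  "cov_along g f p u V = ddir V p u + christoffel g (f p) (ddir f p u) (V p)"

text \<open>Orthogonal projection to the normal space; well defined when the induced metric is
  nondegenerate.\<close>

definition normal_part ::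
    "('e::euclidean_space) metric \<Rightarrow> ('a::euclidean_space \<Rightarrow> 'e) \<Rightarrow> 'a \<Rightarrow> 'e \<Rightarrow> 'e" where
  "normal_part g f p x =
     (THE y. (\<forall>z. g (f p) y (ddir f p z) = 0) \<and> x - y \<in> range (ddir f p))"

definition second_ff ::
    "('e::euclidean_space) metric \<Rightarrow> ('a::euclidean_space \<Rightarrow> 'e) \<Rightarrow> 'a \<Rightarrow> 'a \<Rightarrow> 'a \<Rightarrow> 'e" where
  "second_ff g f p u v = normal_part g f p (cov_along g f p u (\<lambda>q. ddir f q v))"

definition normal_cov ::
    "('e::euclidean_space) metric \<Rightarrow> ('a::euclidean_space \<Rightarrow> 'e) \<Rightarrow> 'a \<Rightarrow> 'a \<Rightarrow> ('a \<Rightarrow> 'e) \<Rightarrow> 'e" where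
  "normal_cov g f p u \<xi> = normal_part g f p (cov_along g f p u \<xi>)"

text \<open>\<open>R\<^sup>\<bottom>(u,v)\<xi>\<close> for a normal field \<open>\<xi>\<close>; its value at \<open>p\<close> depends only on the value of \<open>\<xi>\<close> at \<open>p\<close>.\<close>

definition normal_curv ::
    "('e::euclidean_space) metric \<Rightarrow> ('a::euclidean_space \<Rightarrow> 'e) \<Rightarrow> 'a \<Rightarrow> 'a \<Rightarrow> 'a \<Rightarrow> ('a \<Rightarrow> 'e) \<Rightarrow> 'e"
where
  "normal_curv g f p u v \<xi> =
     normal_cov g f p u (\<lambda>q. normal_cov g f q v \<xi>) -
     normal_cov g f p v (\<lambda>q. normal_cov g f q u \<xi>)"

definition curv_dot_sff ::
    "('e::euclidean_space) metric \<Rightarrow> ('a::euclidean_space \<Rightarrow> 'e) \<Rightarrow> 'a \<Rightarrow> 'a \<Rightarrow> 'a \<Rightarrow> 'a \<Rightarrow> 'a \<Rightarrow> 'e"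
where
  "curv_dot_sff g f p x y z w =
     normal_curv g f p x y (\<lambda>q. second_ff g f q z w)
     - second_ff g f p (riemann (induced_metric g f) p x y z) w
     - second_ff g f p z (riemann (induced_metric g f) p x y w)"

text \<open>The trace is taken with respect to the induced metric, i.e. by contracting with the inverse
  of the Gram matrix of the coordinate frame.\<close>

definition mean_curvature ::
    "('e::euclidean_space) metric \<Rightarrow> (real ^ 'n \<Rightarrow> 'e) \<Rightarrow> real ^ 'n \<Rightarrow> 'e" where
  "mean_curvature g f p =
     (let G = (\<chi> i j. induced_metric g f p (axis i 1) (axis j 1)) :: real ^ 'n ^ 'n
      in (1 / real CARD('n)) *\<^sub>R
         (\<Sum>i\<in>UNIV. \<Sum>j\<in>UNIV. matrix_inv G $ i $ j *\<^sub>R second_ff g f p (axis i 1) (axis j 1)))"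

section \<open>Conditions on an immersed manifold\<close>

text \<open>The conditions below are tensorial, so they are read in the charts of the given atlas.\<close>

definition spacelike ::
    "('e::euclidean_space) metric \<Rightarrow> ('m, 'n::finite) chart set \<Rightarrow> ('m \<Rightarrow> 'e) \<Rightarrow> bool" where
  "spacelike g \<A> F \<longleftrightarrow>
     (\<forall>(U, \<phi>)\<in>\<A>. \<forall>p\<in>\<phi> ` U. \<forall>v. v \<noteq> 0 \<longrightarrow> 0 < induced_metric g (F \<circ> inv_into U \<phi>) p v v)"

definition extremal ::
    "('e::euclidean_space) metric \<Rightarrow> ('m, 'n::finite) chart set \<Rightarrow> ('m \<Rightarrow> 'e) \<Rightarrow> bool" where
  "extremal g \<A> F \<longleftrightarrow>
     (\<forall>(U, \<phi>)\<in>\<A>. \<forall>p\<in>\<phi> ` U. mean_curvature g (F \<circ> inv_into U \<phi>) p = 0)"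

definition semi_parallel ::
    "('e::euclidean_space) metric \<Rightarrow> ('m, 'n::finite) chart set \<Rightarrow> ('m \<Rightarrow> 'e) \<Rightarrow> bool" where
  "semi_parallel g \<A> F \<longleftrightarrow>
     (\<forall>(U, \<phi>)\<in>\<A>. \<forall>p\<in>\<phi> ` U. \<forall>x y z w. curv_dot_sff g (F \<circ> inv_into U \<phi>) p x y z w = 0)"

section \<open>Einstein-de Sitter spacetime\<close>

definition lorentzian_warped_metric :: "(real \<Rightarrow> real) \<Rightarrow> (real \<times> 'a::euclidean_space) metric" where
  "lorentzian_warped_metric a = (\<lambda>(t, x) (s, v) (r, w). - (s * r) + (a t)\<^sup>2 * (v \<bullet> w))"

definition eds_spacetime :: "(real \<times> (real ^ 'n)) set" where
  "eds_spacetime = {0<..} \<times> UNIV"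

definition eds_metric :: "(real \<times> (real ^ 'n)) metric" where
  "eds_metric = lorentzian_warped_metric (\<lambda>t. t powr (1 / 3))"

text \<open>Hypersurfaces are immersed (not necessarily embedded, connected or complete) and nonempty;
  codimension one is enforced by the types.\<close>

definition eds_hypersurface ::
    "'m topology \<Rightarrow> ('m, 'n::finite) chart set \<Rightarrow> ('m \<Rightarrow> real \<times> (real ^ 'n)) \<Rightarrow> bool" where
  "eds_hypersurface M \<A> F \<longleftrightarrow>
     smooth_manifold M \<A> \<and> topspace M \<noteq> {} \<and> F ` topspace M \<subseteq> eds_spacetime \<and> immersion \<A> F"

end

theory Submission
  imports Defs
begin

text \<open>The second fundamental form of a hypersurface with the prescribed properties would have to
  vanish identically, and the Codazzi equation rules that out.

  Fix a point of the hypersurface. The normal line is spanned by a timelike vector \<open>N\<close>, so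
  \<open>\<alpha> = A N\<close> for a symmetric bilinear form \<open>A\<close> on the tangent space, which carries the positive
  definite induced metric \<open>h\<close>. The normal curvature is skew with respect to the ambient metric; pairing
  \<open>(R \<cdot> \<alpha>)(z, z) = 0\<close> with \<open>\<alpha>(z, z)\<close> therefore eliminates it and leaves
  \<open>A(R(x, y)z, z) A(z, z) = 0\<close> for all \<open>x, y, z\<close>
  (\<open>semi_parallel_second_ff\<close>). Suppose \<open>A \<noteq> 0\<close>. The trace of \<open>A\<close> is zero, so \<open>A\<close> has orthogonal
  eigenvectors \<open>e, d\<close> with eigenvalues \<open>l > 0 > m\<close> (\<open>traceless_form_eigenvectors\<close>). Inserting
  \<open>z = e + s d\<close> shows that the sectional curvature of \<open>h\<close> on the plane of \<open>e\<close> and \<open>d\<close> is zero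
  (\<open>skew_commuting_eigenvectors\<close>). By the Gauss equation, however, this curvature is the ambient one,
  which is nonnegative on spacelike planes (\<open>ambient_sectional_nonneg\<close>), plus
  \<open>l m g(N, N) h(e, e) h(d, d)\<close>, which is positive because both \<open>l m\<close> and \<open>g(N, N)\<close> are negative. Hence
  \<open>A = 0\<close>.

  So the hypersurface is totally geodesic, and the ambient curvature maps tangent vectors to
  tangent vectors. The normal component of the curvature of the Einstein-de Sitter metric is
  a nonzero multiple of \<open>dt(X) h(Y, Z) - dt(Y) h(X, Z)\<close>; a choice of \<open>Y = Z\<close> orthogonal to \<open>X\<close>, possible
  in dimension at least two, gives \<open>dt(X) = 0\<close>. Near each of its points the hypersurface lies in a slice of constant time. Such
  slices are not totally geodesic, since the expansion of space gives \<open>\<nabla>\<^sub>X X\<close> a positive time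
  component.

  The Gauss equation and its companions are proved for any field of scalar products and connection
  along an immersion that behaves like a Levi-Civita connection (locale \<open>spacelike_immersion\<close>), and the
  Einstein-de Sitter metric is an instance.\<close>

section \<open>Calculus of smooth maps\<close>

lemma Ck_on_SucD: "Ck_on (Suc k) S f \<Longrightarrow> Ck_on k S f"
proof (induction k arbitrary: f)
  case 0
  then show ?case
    by (auto intro!: continuous_at_imp_continuous_on differentiable_imp_continuous_within)
next
  case (Suc k)
  have "Ck_on k S (\<lambda>p. ddir f p v)" for v
    using Suc.prems by (intro Suc.IH) simp
  then show ?case using Suc.prems by simp
qed

lemma ddir_cong_open:
  assumes "open S" "p \<in> S" "\<And>q. q \<in> S \<Longrightarrow> f q = g q"
  shows "ddir f p = ddir g p"
proof -
  have "(f has_derivative D) (at p) \<longleftrightarrow> (g has_derivative D) (at p)" for D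
    using has_derivative_transform_within_open[of f D p UNIV S g]
      has_derivative_transform_within_open[of g D p UNIV S f] assms by auto
  then show ?thesis by (simp add: frechet_derivative_def)
qed

lemma differentiable_cong_open:
  assumes "open S" "p \<in> S" "\<And>q. q \<in> S \<Longrightarrow> f q = g q"
  shows "f differentiable (at p) \<longleftrightarrow> g differentiable (at p)"
  using has_derivative_transform_within_open[of f _ p UNIV S g]
      has_derivative_transform_within_open[of g _ p UNIV S f] assms
  unfolding differentiable_def by auto

lemma Ck_on_cong:
  assumes "open S" "\<And>q. q \<in> S \<Longrightarrow> f q = g q"
  shows "Ck_on k S f \<longleftrightarrow> Ck_on k S g"
  using assms(2)
proof (induction k arbitrary: f g)
  case 0
  then show ?case by (simp cong: continuous_on_cong)
next
  case (Suc k)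
  have "ddir f p v = ddir g p v" if "p \<in> S" for p v
    using ddir_cong_open[OF assms(1) that, of f g] Suc.prems by simp
  then have "Ck_on k S (\<lambda>p. ddir f p v) \<longleftrightarrow> Ck_on k S (\<lambda>p. ddir g p v)" for v
    by (intro Suc.IH) simp
  moreover have "f differentiable (at p) \<longleftrightarrow> g differentiable (at p)" if "p \<in> S" for p
    using differentiable_cong_open[OF assms(1) that, of f g] Suc.prems by simp
  ultimately show ?case by simp
qed

text \<open>To raise the differentiability class it suffices to exhibit any family of linear maps that
  serves as the derivative.\<close>

lemma Ck_on_SucI:
  assumes "open S" "\<And>p. p \<in> S \<Longrightarrow> (f has_derivative D p) (at p)"
    "\<And>v. Ck_on k S (\<lambda>p. D p v)"
  shows "Ck_on (Suc k) S f"
proof -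
  have "ddir f p = D p" if "p \<in> S" for p
    using frechet_derivative_at[OF assms(2)[OF that]] by simp
  then have "Ck_on k S (\<lambda>p. ddir f p v)" for v
    using assms(3)[of v] Ck_on_cong[OF assms(1), of "\<lambda>p. ddir f p v" "\<lambda>p. D p v" k] by simp
  moreover have "f differentiable (at p)" if "p \<in> S" for p
    using assms(2)[OF that] unfolding differentiable_def by blast
  ultimately show ?thesis by simp
qed

lemma Ck_on_SucE:
  assumes "Ck_on (Suc k) S f" "p \<in> S"
  shows "(f has_derivative ddir f p) (at p)"
  using assms frechet_derivative_works by auto

lemma Ck_on_const: "Ck_on k S (\<lambda>_. c)"
  by (induction k arbitrary: c) (auto)

lemma Ck_on_add:
  assumes "open S" "Ck_on k S f" "Ck_on k S g"
  shows "Ck_on k S (\<lambda>p. f p + g p)"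
  using assms(2,3)
proof (induction k arbitrary: f g)
  case 0 then show ?case by (simp add: continuous_on_add)
next
  case (Suc k)
  show ?case
    by (rule Ck_on_SucI[OF assms(1) has_derivative_add[OF Ck_on_SucE[OF Suc.prems(1)] Ck_on_SucE[OF Suc.prems(2)]]])
      (use Suc in auto)
qed

lemma Ck_on_bounded_linear:
  assumes "open S" "bounded_linear L" "Ck_on k S f"
  shows "Ck_on k S (\<lambda>p. L (f p))"
  using assms(3)
proof (induction k arbitrary: f)
  case 0 then show ?case
    using assms(2) by (simp add: bounded_linear.continuous_on)
next
  case (Suc k)
  show ?case
    by (rule Ck_on_SucI[OF assms(1) bounded_linear.has_derivative[OF assms(2) Ck_on_SucE[OF Suc.prems(1)]]])
      (use Suc in auto)
qed

lemma Ck_on_bounded_bilinear: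
  assumes "open S" "bounded_bilinear B" "Ck_on k S f" "Ck_on k S g"
  shows "Ck_on k S (\<lambda>p. B (f p) (g p))"
  using assms(3,4)
proof (induction k arbitrary: f g)
  case 0 then show ?case
    using assms(2) by (simp add: bounded_bilinear.continuous_on)
next
  case (Suc k)
  have 1: "Ck_on k S f" "Ck_on k S g" "Ck_on k S (\<lambda>p. ddir f p v)" "Ck_on k S (\<lambda>p. ddir g p v)" for v
    using Suc.prems by (blast intro: Ck_on_SucD, blast intro: Ck_on_SucD, simp_all)
  show ?case
    by (rule Ck_on_SucI[OF assms(1) bounded_bilinear.FDERIV[OF assms(2) Ck_on_SucE[OF Suc.prems(1)] Ck_on_SucE[OF Suc.prems(2)]]])
      (assumption | intro Ck_on_add[OF assms(1)] Suc.IH 1)+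
qed

lemma Ck_on_inverse:
  fixes f :: "'a::euclidean_space \<Rightarrow> real"
  assumes "open S" "Ck_on k S f" "\<And>p. p \<in> S \<Longrightarrow> f p \<noteq> 0"
  shows "Ck_on k S (\<lambda>p. inverse (f p))"
  using assms(2)
proof (induction k)
  case 0 then show ?case using assms(3) by (simp add: continuous_on_inverse)
next
  case (Suc k)
  note m = Ck_on_bounded_bilinear[OF assms(1) bounded_bilinear_mult]
  have 1: "Ck_on k S (\<lambda>p. inverse (f p))" "Ck_on k S (\<lambda>p. ddir f p v)" for v
    using Suc Ck_on_SucD by auto
  have "Ck_on k S (\<lambda>p. - (inverse (f p) * ddir f p v * inverse (f p)))" for v
    by (intro Ck_on_bounded_linear[OF assms(1) bounded_linear_minus[OF bounded_linear_ident]] m 1)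
  then show ?case
    by (intro Ck_on_SucI[OF assms(1) Deriv.has_derivative_inverse[OF assms(3) Ck_on_SucE[OF Suc.prems]]])
qed

text \<open>The exponent varies in the induction, since differentiation lowers it by one.\<close>

lemma Ck_on_powr:
  fixes f :: "'a::euclidean_space \<Rightarrow> real"
  assumes "open S" "Ck_on k S f" "\<And>p. p \<in> S \<Longrightarrow> 0 < f p"
  shows "Ck_on k S (\<lambda>p. f p powr c)"
  using assms(2)
proof (induction k arbitrary: c)
  case 0 then show ?case using assms(3) by (auto intro!: continuous_on_powr' continuous_on_const) fastforce+
next
  case (Suc k)
  note m = Ck_on_bounded_bilinear[OF assms(1) bounded_bilinear_mult]
  have 1: "Ck_on k S (\<lambda>p. f p powr (c - 1))" "Ck_on k S (\<lambda>p. ddir f p v)" for v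
    using Suc Ck_on_SucD by auto
  have "Ck_on k S (\<lambda>p. c * f p powr (c - 1) * ddir f p v)" for v
    by (intro m 1 Ck_on_const)
  moreover have "((\<lambda>q. f q powr c) has_derivative (\<lambda>v. c * f p powr (c - 1) * ddir f p v)) (at p)"
    if "p \<in> S" for p
    using has_derivative_compose[OF Ck_on_SucE[OF Suc.prems that],
        of "\<lambda>t. t powr c" "\<lambda>v. c * f p powr (c - 1) * v"]
      has_real_derivative_powr[OF assms(3)[OF that], of c]
    by (simp add: has_field_derivative_def)
  ultimately show ?case
    by (intro Ck_on_SucI[OF assms(1)])
qed

lemma smooth_on_const: "smooth_on S (\<lambda>_. c)"
  by (simp add: smooth_on_def Ck_on_const)

lemma smooth_on_cong:
  assumes "open S" "\<And>q. q \<in> S \<Longrightarrow> f q = g q"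
  shows "smooth_on S f \<longleftrightarrow> smooth_on S g"
  using Ck_on_cong[OF assms] by (simp add: smooth_on_def)

lemma smooth_on_add:
  "open S \<Longrightarrow> smooth_on S f \<Longrightarrow> smooth_on S g \<Longrightarrow> smooth_on S (\<lambda>p. f p + g p)"
  by (simp add: smooth_on_def Ck_on_add)

lemma smooth_on_bounded_linear:
  "open S \<Longrightarrow> bounded_linear L \<Longrightarrow> smooth_on S f \<Longrightarrow> smooth_on S (\<lambda>p. L (f p))"
  by (simp add: smooth_on_def Ck_on_bounded_linear)

lemma smooth_on_bounded_bilinear:
  "open S \<Longrightarrow> bounded_bilinear B \<Longrightarrow> smooth_on S f \<Longrightarrow> smooth_on S g \<Longrightarrow>
    smooth_on S (\<lambda>p. B (f p) (g p))"
  by (simp add: smooth_on_def Ck_on_bounded_bilinear)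

lemmas smooth_on_mult = smooth_on_bounded_bilinear[OF _ bounded_bilinear_mult]
lemmas smooth_on_scaleR = smooth_on_bounded_bilinear[OF _ bounded_bilinear_scaleR]
lemmas smooth_on_inner = smooth_on_bounded_bilinear[OF _ bounded_bilinear_inner]
lemmas smooth_on_fst = smooth_on_bounded_linear[OF _ bounded_linear_fst]
lemmas smooth_on_snd = smooth_on_bounded_linear[OF _ bounded_linear_snd]
lemmas smooth_on_minus = smooth_on_bounded_linear[OF _ bounded_linear_minus[OF bounded_linear_ident]]

lemma smooth_on_diff:
  "open S \<Longrightarrow> smooth_on S f \<Longrightarrow> smooth_on S g \<Longrightarrow> smooth_on S (\<lambda>p. f p - g p)"
  using smooth_on_add[of S f "\<lambda>p. - g p"] smooth_on_minus[of S g] by simp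

lemma smooth_on_inverse:
  fixes f :: "'a::euclidean_space \<Rightarrow> real"
  shows "open S \<Longrightarrow> smooth_on S f \<Longrightarrow> (\<And>p. p \<in> S \<Longrightarrow> f p \<noteq> 0) \<Longrightarrow>
    smooth_on S (\<lambda>p. inverse (f p))"
  by (simp add: smooth_on_def Ck_on_inverse)

lemma smooth_on_powr:
  fixes f :: "'a::euclidean_space \<Rightarrow> real"
  shows "open S \<Longrightarrow> smooth_on S f \<Longrightarrow> (\<And>p. p \<in> S \<Longrightarrow> 0 < f p) \<Longrightarrow>
    smooth_on S (\<lambda>p. f p powr c)"
  by (simp add: smooth_on_def Ck_on_powr)

lemma smooth_on_Pair:
  assumes "open S" "smooth_on S f" "smooth_on S g"
  shows "smooth_on S (\<lambda>p. (f p, g p))"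
  using smooth_on_add[OF assms(1)
      smooth_on_bounded_linear[OF assms(1) bounded_linear_Pair[OF bounded_linear_ident bounded_linear_zero] assms(2)]
      smooth_on_bounded_linear[OF assms(1) bounded_linear_Pair[OF bounded_linear_zero bounded_linear_ident] assms(3)]]
  by simp

lemma smooth_on_sum:
  assumes "open S" "\<And>i. i \<in> I \<Longrightarrow> smooth_on S (f i)"
  shows "smooth_on S (\<lambda>p. \<Sum>i\<in>I. f i p)"
  using assms(2)
  by (induction I rule: infinite_finite_induct)
    (simp_all add: smooth_on_const smooth_on_add[OF assms(1)])

lemma smooth_on_prod:
  fixes f :: "'i \<Rightarrow> 'a::euclidean_space \<Rightarrow> real"
  assumes "open S" "\<And>i. i \<in> I \<Longrightarrow> smooth_on S (f i)"
  shows "smooth_on S (\<lambda>p. \<Prod>i\<in>I. f i p)"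
  using assms(2)
  by (induction I rule: infinite_finite_induct)
    (simp_all add: smooth_on_const smooth_on_mult[OF assms(1)])

lemma smooth_on_ddir: "smooth_on S f \<Longrightarrow> smooth_on S (\<lambda>p. ddir f p v)"
  unfolding smooth_on_def using Ck_on.simps(2) by blast

lemma smooth_on_has_derivative:
  "smooth_on S f \<Longrightarrow> p \<in> S \<Longrightarrow> (f has_derivative ddir f p) (at p)"
  unfolding smooth_on_def using Ck_on_SucE by blast

lemma smooth_on_continuous_on: "smooth_on S f \<Longrightarrow> continuous_on S f"
  unfolding smooth_on_def using Ck_on.simps(1) by blast

lemma linear_ddir: "smooth_on S f \<Longrightarrow> p \<in> S \<Longrightarrow> linear (ddir f p)"
  using smooth_on_has_derivative has_derivative_linear by blast

lemma ddir_eqI: "(f has_derivative D) (at p) \<Longrightarrow> ddir f p v = D v"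
  using frechet_derivative_at[of f D p] by simp

lemma ddir_add:
  assumes "smooth_on S f" "smooth_on S g" "p \<in> S"
  shows "ddir (\<lambda>q. f q + g q) p u = ddir f p u + ddir g p u"
  by (rule ddir_eqI[OF has_derivative_add[OF assms(1,2)[THEN smooth_on_has_derivative[OF _ assms(3)]]]])

lemma ddir_bounded_linear:
  assumes "bounded_linear L" "smooth_on S f" "p \<in> S"
  shows "ddir (\<lambda>q. L (f q)) p u = L (ddir f p u)"
  by (rule ddir_eqI[OF bounded_linear.has_derivative[OF assms(1) smooth_on_has_derivative[OF assms(2,3)]]])

lemma ddir_bounded_bilinear:
  assumes "bounded_bilinear B" "smooth_on S f" "smooth_on S g" "p \<in> S"
  shows "ddir (\<lambda>q. B (f q) (g q)) p u = B (f p) (ddir g p u) + B (ddir f p u) (g p)"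
  by (rule ddir_eqI[OF bounded_bilinear.FDERIV[OF assms(1)
      assms(2,3)[THEN smooth_on_has_derivative[OF _ assms(4)]]]])

lemmas ddir_mult = ddir_bounded_bilinear[OF bounded_bilinear_mult]
lemmas ddir_scaleR = ddir_bounded_bilinear[OF bounded_bilinear_scaleR]
lemmas ddir_inner = ddir_bounded_bilinear[OF bounded_bilinear_inner]
lemmas ddir_fst = ddir_bounded_linear[OF bounded_linear_fst]
lemmas ddir_snd = ddir_bounded_linear[OF bounded_linear_snd]

lemma ddir_sum:
  assumes "open S" "\<And>i. i \<in> I \<Longrightarrow> smooth_on S (f i)" "p \<in> S"
  shows "ddir (\<lambda>q. \<Sum>i\<in>I. f i q) p u = (\<Sum>i\<in>I. ddir (f i) p u)"
  using assms(2)
  by (induction I rule: infinite_finite_induct)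
    (simp_all add: ddir_add[OF _ _ assms(3)] smooth_on_sum[OF assms(1)])

lemma ddir_powr:
  fixes f :: "'a::euclidean_space \<Rightarrow> real"
  assumes "smooth_on S f" "p \<in> S" "0 < f p"
  shows "ddir (\<lambda>q. f q powr c) p u = c * f p powr (c - 1) * ddir f p u"
proof -
  have "((\<lambda>q. f q powr c) has_derivative (\<lambda>v. c * f p powr (c - 1) * ddir f p v)) (at p)"
    using has_derivative_compose[OF smooth_on_has_derivative[OF assms(1,2)],
        of "\<lambda>t. t powr c" "\<lambda>v. c * f p powr (c - 1) * v"]
      has_real_derivative_powr[OF assms(3), of c]
    by (simp add: has_field_derivative_def)
  then show ?thesis by (rule ddir_eqI)
qed

text \<open>The mean value theorem, applied first in direction \<open>u\<close> and then in direction \<open>v\<close>, turns the second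
  difference over a parallelogram into a value of the mixed second derivative inside it. The second
  difference is symmetric in \<open>u\<close> and \<open>v\<close>, which is what makes mixed derivatives commute.\<close>

lemma second_difference_mean_value:
  fixes \<phi> :: "'a::euclidean_space \<Rightarrow> real"
  assumes sm: "smooth_on S \<phi>" and "0 < s"
    and sub: "\<And>a b. 0 \<le> a \<Longrightarrow> a \<le> s \<Longrightarrow> 0 \<le> b \<Longrightarrow> b \<le> s \<Longrightarrow> p + a *\<^sub>R u + b *\<^sub>R v \<in> S"
  obtains a b where "0 < a" "a < s" "0 < b" "b < s"
    "\<phi> (p + s *\<^sub>R u + s *\<^sub>R v) - \<phi> (p + s *\<^sub>R u) - \<phi> (p + s *\<^sub>R v) + \<phi> p =
      s * s * ddir (\<lambda>q. ddir \<phi> q u) (p + a *\<^sub>R u + b *\<^sub>R v) v"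
proof -
  have D: "((\<lambda>a. \<psi> (x + a *\<^sub>R w)) has_derivative (\<lambda>h. h * ddir \<psi> (x + a *\<^sub>R w) w)) (at a)"
    if "smooth_on S \<psi>" "x + a *\<^sub>R w \<in> S" for \<psi> :: "'a \<Rightarrow> real" and x w a
  proof -
    have "((\<lambda>a. x + a *\<^sub>R w) has_derivative (\<lambda>h. h *\<^sub>R w)) (at a)"
      by (auto intro!: derivative_eq_intros)
    from has_derivative_compose[OF this smooth_on_has_derivative[OF that]]
    show ?thesis using linear_ddir[OF that] by (simp add: linear_cmul)
  qed
  define c where "c = (\<lambda>a. \<phi> (p + s *\<^sub>R v + a *\<^sub>R u) - \<phi> (p + a *\<^sub>R u))"
  have Dc: "(c has_derivative (\<lambda>h. h * ddir \<phi> (p + s *\<^sub>R v + a *\<^sub>R u) u - h * ddir \<phi> (p + a *\<^sub>R u) u)) (at a)"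
    if "0 \<le> a" "a \<le> s" for a
    unfolding c_def
    using sub[of a s] sub[of a 0] that \<open>0 < s\<close>
    by (intro has_derivative_diff D[OF sm]) (auto simp: add_ac)
  obtain a where a: "0 < a" "a < s" and
    A: "c s - c 0 = s * ddir \<phi> (p + s *\<^sub>R v + a *\<^sub>R u) u - s * ddir \<phi> (p + a *\<^sub>R u) u"
    using mvt_simple[OF \<open>0 < s\<close> has_derivative_at_withinI[OF Dc]] by auto
  define \<omega> where "\<omega> = (\<lambda>b. ddir \<phi> (p + a *\<^sub>R u + b *\<^sub>R v) u)"
  have D\<omega>: "(\<omega> has_derivative (\<lambda>h. h * ddir (\<lambda>q. ddir \<phi> q u) (p + a *\<^sub>R u + b *\<^sub>R v) v)) (at b)"
    if "0 \<le> b" "b \<le> s" for b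
    unfolding \<omega>_def
    using sub[of a b] that a by (intro D[OF smooth_on_ddir[OF sm]]) auto
  obtain b where b: "0 < b" "b < s" and
    B: "\<omega> s - \<omega> 0 = s * ddir (\<lambda>q. ddir \<phi> q u) (p + a *\<^sub>R u + b *\<^sub>R v) v"
    using mvt_simple[OF \<open>0 < s\<close> has_derivative_at_withinI[OF D\<omega>]] by auto
  have "c s - c 0 = s * (\<omega> s - \<omega> 0)"
    using A by (simp add: \<omega>_def algebra_simps)
  then have "\<phi> (p + s *\<^sub>R u + s *\<^sub>R v) - \<phi> (p + s *\<^sub>R u) - \<phi> (p + s *\<^sub>R v) + \<phi> p =
      s * s * ddir (\<lambda>q. ddir \<phi> q u) (p + a *\<^sub>R u + b *\<^sub>R v) v"
    using B by (simp add: c_def algebra_simps)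
  then show ?thesis using that a b by blast
qed

text \<open>If the two mixed derivatives differed at \<open>p\<close>, then by continuity they would have disjoint sets of
  values near \<open>p\<close>; but both attain the same second difference quotient over any small parallelogram.\<close>

lemma ddir_commute_real:
  fixes \<phi> :: "'a::euclidean_space \<Rightarrow> real"
  assumes S: "open S" and sm: "smooth_on S \<phi>" and p: "p \<in> S"
  shows "ddir (\<lambda>q. ddir \<phi> q u) p v = ddir (\<lambda>q. ddir \<phi> q v) p u"
proof (rule ccontr)
  define F where "F = (\<lambda>q. ddir (\<lambda>q. ddir \<phi> q u) q v)"
  define G where "G = (\<lambda>q. ddir (\<lambda>q. ddir \<phi> q v) q u)"
  assume "\<not> ?thesis"
  then have FG: "F p \<noteq> G p" by (simp add: F_def G_def)
  define \<delta> where "\<delta> = dist (F p) (G p) / 2"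
  have \<delta>: "0 < \<delta>" using FG by (simp add: \<delta>_def)
  have "isCont F p" "isCont G p"
    unfolding F_def G_def
    using smooth_on_continuous_on[OF smooth_on_ddir[OF smooth_on_ddir[OF sm]]] S p
    by (simp_all add: continuous_on_eq_continuous_at)
  then have "\<exists>r>0. \<forall>q. dist q p < r \<longrightarrow> dist (F q) (F p) < \<delta>"
    "\<exists>r>0. \<forall>q. dist q p < r \<longrightarrow> dist (G q) (G p) < \<delta>"
    using \<delta> unfolding continuous_at_eps_delta by blast+
  then obtain r1 r2 where r: "0 < r1" "\<And>q. dist q p < r1 \<Longrightarrow> dist (F q) (F p) < \<delta>"
    "0 < r2" "\<And>q. dist q p < r2 \<Longrightarrow> dist (G q) (G p) < \<delta>"
    by blast
  obtain r0 where r0: "0 < r0" "ball p r0 \<subseteq> S" using S p open_contains_ball by blast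
  define r where "r = min r0 (min r1 r2)"
  \<comment> \<open>small enough for the parallelogram with sides \<open>s u\<close> and \<open>s v\<close> to stay in the ball of radius \<open>r\<close>\<close>
  define s where "s = r / 2 / (norm u + norm v + 1)"
  have rpos: "0 < r" using r r0 by (simp add: r_def)
  have npos: "0 < norm u + norm v + 1" by (intro add_nonneg_pos) auto
  have spos: "0 < s" unfolding s_def using rpos npos by simp
  have cancel: "x / N * N = x" if "0 < N" for x N :: real using that by simp
  have near: "dist (p + a *\<^sub>R u + b *\<^sub>R v) p < r" if "0 \<le> a" "a \<le> s" "0 \<le> b" "b \<le> s" for a b
  proof -
    have "dist (p + a *\<^sub>R u + b *\<^sub>R v) p \<le> a * norm u + b * norm v"
      using norm_triangle_ineq[of "a *\<^sub>R u" "b *\<^sub>R v"] that by (simp add: dist_norm algebra_simps)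
    also have "\<dots> \<le> s * norm u + s * norm v"
      using that by (intro add_mono mult_right_mono) auto
    also have "\<dots> \<le> s * (norm u + norm v + 1)" using spos by (simp add: algebra_simps)
    also have "\<dots> = r / 2"
      unfolding s_def by (rule cancel[OF npos])
    also have "\<dots> < r" using rpos by simp
    finally show ?thesis .
  qed
  have sub: "p + a *\<^sub>R u + b *\<^sub>R v \<in> S" if "0 \<le> a" "a \<le> s" "0 \<le> b" "b \<le> s" for a b
    using near[OF that] r0 by (auto simp: r_def subset_iff dist_commute)
  have sub': "p + a *\<^sub>R v + b *\<^sub>R u \<in> S" if "0 \<le> a" "a \<le> s" "0 \<le> b" "b \<le> s" for a b
    using sub[OF that(3,4,1,2)] by (simp add: add_ac)
  obtain a b where ab: "0 < a" "a < s" "0 < b" "b < s"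
    "\<phi> (p + s *\<^sub>R u + s *\<^sub>R v) - \<phi> (p + s *\<^sub>R u) - \<phi> (p + s *\<^sub>R v) + \<phi> p =
      s * s * F (p + a *\<^sub>R u + b *\<^sub>R v)"
    unfolding F_def by (rule second_difference_mean_value[OF sm spos sub]) blast+
  obtain c d where cd: "0 < c" "c < s" "0 < d" "d < s"
    "\<phi> (p + s *\<^sub>R v + s *\<^sub>R u) - \<phi> (p + s *\<^sub>R v) - \<phi> (p + s *\<^sub>R u) + \<phi> p =
      s * s * G (p + c *\<^sub>R v + d *\<^sub>R u)"
    unfolding G_def by (rule second_difference_mean_value[OF sm spos sub']) blast+
  have swap: "p + s *\<^sub>R v + s *\<^sub>R u = p + s *\<^sub>R u + s *\<^sub>R v" by (simp add: add_ac)
  have "s * s * F (p + a *\<^sub>R u + b *\<^sub>R v) = s * s * G (p + c *\<^sub>R v + d *\<^sub>R u)"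
    using ab(5) cd(5)[unfolded swap] by linarith
  then have eq: "F (p + a *\<^sub>R u + b *\<^sub>R v) = G (p + d *\<^sub>R u + c *\<^sub>R v)"
    using spos by (simp add: add_ac)
  have "dist (F (p + a *\<^sub>R u + b *\<^sub>R v)) (F p) < \<delta>" "dist (G (p + d *\<^sub>R u + c *\<^sub>R v)) (G p) < \<delta>"
    using near[of a b] near[of d c] ab cd r by (auto simp: r_def)
  then have "dist (F p) (G p) < \<delta> + \<delta>"
    unfolding eq using dist_triangle3[of "F p" "G p" "G (p + d *\<^sub>R u + c *\<^sub>R v)"] by linarith
  then show False by (simp add: \<delta>_def)
qed

lemma ddir_commute:
  fixes f :: "'a::euclidean_space \<Rightarrow> 'b::euclidean_space"
  assumes S: "open S" and sm: "smooth_on S f" and p: "p \<in> S"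
  shows "ddir (\<lambda>q. ddir f q u) p v = ddir (\<lambda>q. ddir f q v) p u"
proof (rule euclidean_eqI)
  fix b :: 'b
  have sb: "smooth_on S (\<lambda>q. f q \<bullet> b)"
    by (rule smooth_on_bounded_linear[OF S bounded_linear_inner_left sm])
  have *: "ddir (\<lambda>q. ddir f q u) p v \<bullet> b = ddir (\<lambda>q. ddir (\<lambda>q. f q \<bullet> b) q u) p v" for u v
  proof -
    have "ddir (\<lambda>q. ddir f q u) p v \<bullet> b = ddir (\<lambda>q. ddir f q u \<bullet> b) p v"
      using ddir_bounded_linear[OF bounded_linear_inner_left smooth_on_ddir[OF sm] p] by metis
    also have "\<dots> = ddir (\<lambda>q. ddir (\<lambda>q. f q \<bullet> b) q u) p v"
      using ddir_cong_open[OF S p, of "\<lambda>q. ddir f q u \<bullet> b" "\<lambda>q. ddir (\<lambda>q. f q \<bullet> b) q u"]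
        ddir_bounded_linear[OF bounded_linear_inner_left sm] by metis
    finally show ?thesis .
  qed
  show "ddir (\<lambda>q. ddir f q u) p v \<bullet> b = ddir (\<lambda>q. ddir f q v) p u \<bullet> b"
    unfolding * by (rule ddir_commute_real[OF S sb p])
qed

text \<open>The Leibniz rule for applying a moving linear map to a moving vector, reduced
  to the rule for scalar multiples by expanding the vector in a basis.\<close>

lemma
  fixes T :: "'a::euclidean_space \<Rightarrow> 'b::euclidean_space \<Rightarrow> 'c::real_normed_vector"
  assumes S: "open S" and lin: "\<And>q. q \<in> S \<Longrightarrow> linear (T q)"
    and T: "\<And>k. smooth_on S (\<lambda>q. T q k)" and Y: "smooth_on S Y"
  shows smooth_on_linear_field: "smooth_on S (\<lambda>q. T q (Y q))"
    and ddir_linear_field: "p \<in> S \<Longrightarrow>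
      ddir (\<lambda>q. T q (Y q)) p u = ddir (\<lambda>q. T q (Y p)) p u + T p (ddir Y p u)"
proof -
  have expand: "T q y = (\<Sum>b\<in>Basis. (y \<bullet> b) *\<^sub>R T q b)" if "q \<in> S" for q y
    using arg_cong[OF euclidean_representation[of y], of "T q"] lin[OF that]
    by (simp add: linear_sum linear_cmul)
  have Yb: "smooth_on S (\<lambda>q. Y q \<bullet> b)" for b
    by (rule smooth_on_bounded_linear[OF S bounded_linear_inner_left Y])
  have sm: "smooth_on S (\<lambda>q. \<Sum>b\<in>Basis. (Y q \<bullet> b) *\<^sub>R T q b)"
    by (intro smooth_on_sum[OF S] smooth_on_scaleR[OF S] Yb T)
  then show "smooth_on S (\<lambda>q. T q (Y q))"
    using smooth_on_cong[OF S, of "\<lambda>q. T q (Y q)" "\<lambda>q. \<Sum>b\<in>Basis. (Y q \<bullet> b) *\<^sub>R T q b"] expand by simp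
  assume p: "p \<in> S"
  have "ddir (\<lambda>q. T q (Y q)) p u = ddir (\<lambda>q. \<Sum>b\<in>Basis. (Y q \<bullet> b) *\<^sub>R T q b) p u"
    using ddir_cong_open[OF S p, of "\<lambda>q. T q (Y q)" "\<lambda>q. \<Sum>b\<in>Basis. (Y q \<bullet> b) *\<^sub>R T q b"] expand by simp
  also have "\<dots> = (\<Sum>b\<in>Basis. ddir (\<lambda>q. (Y q \<bullet> b) *\<^sub>R T q b) p u)"
    by (intro ddir_sum[OF S _ p] smooth_on_scaleR[OF S] Yb T)
  also have "\<dots> = (\<Sum>b\<in>Basis. (Y p \<bullet> b) *\<^sub>R ddir (\<lambda>q. T q b) p u + (ddir Y p u \<bullet> b) *\<^sub>R T p b)"
    by (intro sum.cong refl)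
      (simp add: ddir_scaleR[OF Yb T p] ddir_bounded_linear[OF bounded_linear_inner_left Y p])
  also have "\<dots> = (\<Sum>b\<in>Basis. (Y p \<bullet> b) *\<^sub>R ddir (\<lambda>q. T q b) p u) + T p (ddir Y p u)"
    by (simp add: sum.distrib expand[OF p, symmetric])
  also have "(\<Sum>b\<in>Basis. (Y p \<bullet> b) *\<^sub>R ddir (\<lambda>q. T q b) p u) =
      (\<Sum>b\<in>Basis. ddir (\<lambda>q. (Y p \<bullet> b) *\<^sub>R T q b) p u)"
    by (intro sum.cong refl) (simp add: ddir_bounded_linear[OF bounded_linear_scaleR_right T p])
  also have "\<dots> = ddir (\<lambda>q. \<Sum>b\<in>Basis. (Y p \<bullet> b) *\<^sub>R T q b) p u"
    by (intro ddir_sum[OF S _ p, symmetric] smooth_on_scaleR[OF S] smooth_on_const T)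
  also have "\<dots> = ddir (\<lambda>q. T q (Y p)) p u"
    using ddir_cong_open[OF S p, of "\<lambda>q. T q (Y p)" "\<lambda>q. \<Sum>b\<in>Basis. (Y p \<bullet> b) *\<^sub>R T q b"] expand by simp
  finally show "ddir (\<lambda>q. T q (Y q)) p u = ddir (\<lambda>q. T q (Y p)) p u + T p (ddir Y p u)" .
qed

lemma smooth_on_vec:
  fixes f :: "'n::finite \<Rightarrow> 'a::euclidean_space \<Rightarrow> real"
  assumes S: "open S" and f: "\<And>k. smooth_on S (f k)"
  shows "smooth_on S (\<lambda>p. (\<chi> k. f k p) :: real ^ 'n)"
proof -
  have "smooth_on S (\<lambda>p. \<Sum>k\<in>UNIV. f k p *\<^sub>R (axis k 1 :: real ^ 'n))"
    by (intro smooth_on_sum[OF S] smooth_on_scaleR[OF S] smooth_on_const f)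
  moreover have "(\<Sum>k\<in>UNIV. f k p *\<^sub>R (axis k 1 :: real ^ 'n)) = (\<chi> k. f k p)" for p
    using basis_expansion[of "\<chi> k. f k p"] by (simp add: scalar_mult_eq_scaleR)
  ultimately show ?thesis by simp
qed

lemma smooth_on_det:
  fixes M :: "'a::euclidean_space \<Rightarrow> real ^ 'n ^ 'n"
  assumes S: "open S" and M: "\<And>i j. smooth_on S (\<lambda>p. M p $ i $ j)"
  shows "smooth_on S (\<lambda>p. det (M p))"
  unfolding det_def
  by (intro smooth_on_sum[OF S] smooth_on_mult[OF S] smooth_on_prod[OF S] smooth_on_const M)

section \<open>Symmetric bilinear forms\<close>

text \<open>The quadratic polynomial \<open>t \<mapsto> A(u + t v, u + t v)\<close> is nonnegative. The degenerate case \<open>A(v, v) = 0\<close>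
  matters: it is what makes null vectors of the form lie in its kernel.\<close>

lemma psd_form_Cauchy_Schwarz:
  fixes A :: "'a::euclidean_space \<Rightarrow> 'a \<Rightarrow> real"
  assumes bil: "bilinear A" and sym: "\<And>u v. A u v = A v u" and psd: "\<And>v. 0 \<le> A v v"
  shows "(A u v)\<^sup>2 \<le> A u u * A v v"
proof -
  have ex: "A (u + t *\<^sub>R v) (u + t *\<^sub>R v) = A u u + 2 * t * A u v + t\<^sup>2 * A v v" for t
    using sym[of u v]
    by (simp add: bilinear_ladd[OF bil] bilinear_radd[OF bil] bilinear_lmul[OF bil]
        bilinear_rmul[OF bil] algebra_simps power2_eq_square)
  show ?thesis
  proof (cases "A v v = 0")
    case True
    have "A u v = 0"
      \<comment> \<open>otherwise the polynomial is affine and not constant; its value is \<open>-1\<close> at the chosen \<open>t\<close>\<close>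
    proof (rule ccontr)
      assume n: "A u v \<noteq> 0"
      have "0 \<le> A u u + 2 * (- (A u u + 1) / (2 * A u v)) * A u v"
        using psd[of "u + (- (A u u + 1) / (2 * A u v)) *\<^sub>R v"] ex[of "- (A u u + 1) / (2 * A u v)"] True
        by simp
      also have "\<dots> = -1" using n by (simp add: field_simps)
      finally show False by simp
    qed
    then show ?thesis using True by simp
  next
    case False
    then have pos: "0 < A v v" using psd[of v] by simp
    \<comment> \<open>\<open>t = - A(u, v) / A(v, v)\<close> minimises the polynomial\<close>
    have "0 \<le> A u u + 2 * (- A u v / A v v) * A u v + (- A u v / A v v)\<^sup>2 * A v v"
      using psd[of "u + (- A u v / A v v) *\<^sub>R v"] ex[of "- A u v / A v v"] by simp
    also have "\<dots> = A u u - (A u v)\<^sup>2 / A v v"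
      using pos by (simp add: field_simps power2_eq_square)
    finally show ?thesis using pos by (simp add: field_simps)
  qed
qed

lemma psd_form_null_vector:
  fixes A :: "'a::euclidean_space \<Rightarrow> 'a \<Rightarrow> real"
  assumes "bilinear A" "\<And>u v. A u v = A v u" "\<And>v. 0 \<le> A v v" "A e e = 0"
  shows "A e v = 0"
  using psd_form_Cauchy_Schwarz[OF assms(1-3), of e v] assms(4) by simp

lemma bilinear_eq_0_on_Basis:
  fixes A :: "'a::euclidean_space \<Rightarrow> 'a \<Rightarrow> real"
  assumes "bilinear A" "\<And>i u. i \<in> Basis \<Longrightarrow> A i u = 0"
  shows "A v u = 0"
proof -
  have "linear (\<lambda>v. A v u)" using assms(1) by (simp add: bilinear_def)
  then show ?thesis
    using linear_eq_on_span[of "\<lambda>v. A v u" "\<lambda>_. 0" Basis v] assms(2) module_hom_zero by auto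
qed

text \<open>Lagrange reduction: subtracting \<open>A(i, u) A(i, v) / A(i, i)\<close> keeps the form positive semidefinite by
  the Cauchy-Schwarz inequality, moves the basis vector \<open>i\<close> into its kernel, and keeps there all
  basis vectors that were already in it. The number of basis vectors outside the kernel drops.\<close>

lemma psd_form_sum_of_squares:
  fixes A :: "'a::euclidean_space \<Rightarrow> 'a \<Rightarrow> real"
  assumes "bilinear A" "\<And>u v. A u v = A v u" "\<And>v. 0 \<le> A v v"
  shows "\<exists>m b. (\<forall>k<m::nat. linear (b k)) \<and> (\<forall>u v. A u v = (\<Sum>k<m. b k u * b k v))"
  using assms
proof (induction "card {i\<in>Basis. \<exists>u. A i u \<noteq> 0}" arbitrary: A rule: less_induct)
  case less
  note bil = less.prems(1) and sym = less.prems(2) and psd = less.prems(3)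
  show ?case
  proof (cases "\<exists>i\<in>Basis. \<exists>u. A i u \<noteq> 0")
    case False
    then have "A u v = 0" for u v using bilinear_eq_0_on_Basis[OF bil] by blast
    then show ?thesis by (intro exI[of _ 0]) simp
  next
    case True
    then obtain i where i: "i \<in> Basis" "\<exists>u. A i u \<noteq> 0" by blast
    have "A i i \<noteq> 0" using psd_form_null_vector[OF bil sym psd, of i] i(2) by auto
    then have pos: "0 < A i i" using psd[of i] by simp
    define A' where "A' = (\<lambda>u v. A u v - A i u * A i v / A i i)"
    have bil': "bilinear A'"
      unfolding bilinear_def A'_def
      by (auto intro!: linearI simp: bilinear_ladd[OF bil] bilinear_radd[OF bil] bilinear_lmul[OF bil]
        bilinear_rmul[OF bil] algebra_simps add_divide_distrib)
    have sym': "A' u v = A' v u" for u v using sym[of u v] by (simp add: A'_def mult.commute)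
    have psd': "0 \<le> A' v v" for v
      using psd_form_Cauchy_Schwarz[OF bil sym psd, of i v] pos
      by (simp add: A'_def field_simps power2_eq_square)
    have "A' i u = 0" for u using pos by (simp add: A'_def)
    moreover have "A' j u = 0" if "\<And>u. A j u = 0" for j u
      using that sym[of i j] by (simp add: A'_def)
    ultimately have "{j\<in>Basis. \<exists>u. A' j u \<noteq> 0} \<subset> {j\<in>Basis. \<exists>u. A j u \<noteq> 0}"
      using i by blast
    then have "card {j\<in>Basis. \<exists>u. A' j u \<noteq> 0} < card {j\<in>Basis. \<exists>u. A j u \<noteq> 0}"
      by (intro psubset_card_mono) auto
    from less.hyps[OF this bil' sym' psd']
    obtain m :: nat and b where b: "\<forall>k<m. linear (b k)" "\<forall>u v. A' u v = (\<Sum>k<m. b k u * b k v)"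
      by blast
    define b' where "b' = b(m := \<lambda>u. A i u / sqrt (A i i))"
    have "linear (\<lambda>u. A i u / sqrt (A i i))"
      by (auto intro!: linearI simp: bilinear_radd[OF bil] bilinear_rmul[OF bil] add_divide_distrib)
    then have "\<forall>k<Suc m. linear (b' k)" using b(1) by (auto simp: b'_def less_Suc_eq)
    moreover have "A u v = (\<Sum>k<Suc m. b' k u * b' k v)" for u v
    proof -
      have "A u v = A' u v + A i u * A i v / A i i" by (simp add: A'_def)
      also have "A i u * A i v / A i i = b' m u * b' m v"
        using pos by (simp add: b'_def)
      also have "A' u v = (\<Sum>k<m. b' k u * b' k v)"
        unfolding b(2)[rule_format] by (intro sum.cong) (auto simp: b'_def)
      finally show ?thesis by simp
    qed
    ultimately show ?thesis by blast
  qed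
qed

lemma linear_eq_0_on_axis:
  fixes b :: "real ^ 'n \<Rightarrow> real"
  assumes "linear b" "\<And>i. b (axis i 1) = 0"
  shows "b v = 0"
proof (rule linear_eq_on_span[of b "\<lambda>_. 0" Basis, OF assms(1) module_hom_zero])
  show "b x = 0" if "x \<in> Basis" for x using that assms(2) by (auto simp: Basis_vec_def)
  show "v \<in> span Basis" by (simp only: span_Basis UNIV_I)
qed

text \<open>Writing \<open>A\<close> as a sum of squares of functionals exhibits the \<open>P\<close>-trace as a sum of values of the
  positive definite form \<open>P\<close>, one for each functional.\<close>

lemma psd_form_trace_eq_0:
  fixes A :: "real ^ 'n \<Rightarrow> real ^ 'n \<Rightarrow> real" and P :: "real ^ 'n ^ 'n"
  assumes A: "bilinear A" "\<And>u v. A u v = A v u" "\<And>v. 0 \<le> A v v"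
    and P: "\<And>x. x \<noteq> 0 \<Longrightarrow> 0 < x \<bullet> (P *v x)"
    and trace: "(\<Sum>i\<in>UNIV. \<Sum>j\<in>UNIV. P $ i $ j * A (axis i 1) (axis j 1)) = 0"
  shows "A u v = 0"
proof -
  obtain m :: nat and b where b: "\<And>k. k < m \<Longrightarrow> linear (b k)" "\<And>u v. A u v = (\<Sum>k<m. b k u * b k v)"
    using psd_form_sum_of_squares[OF A] by blast
  define x where "x k = (\<chi> i. b k (axis i 1))" for k
  have nonneg: "0 \<le> x k \<bullet> (P *v x k)" for k
    using P[of "x k"] by (cases "x k = 0") (auto intro: less_imp_le)
  have "(\<Sum>k<m. x k \<bullet> (P *v x k)) =
      (\<Sum>k<m. \<Sum>i\<in>UNIV. \<Sum>j\<in>UNIV. P $ i $ j * (b k (axis i 1) * b k (axis j 1)))"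
    by (simp add: inner_vec_def matrix_vector_mult_def x_def sum_distrib_left mult_ac)
  also have "\<dots> = (\<Sum>i\<in>UNIV. \<Sum>j\<in>UNIV. P $ i $ j * A (axis i 1) (axis j 1))"
    unfolding b(2) sum_distrib_left
    by (subst sum.swap, intro sum.cong refl, subst sum.swap) (rule refl)
  finally have "(\<Sum>k<m. x k \<bullet> (P *v x k)) = 0" using trace by simp
  then have "x k \<bullet> (P *v x k) = 0" if "k < m" for k
    using sum_nonneg_eq_0_iff[of "{..<m}" "\<lambda>k. x k \<bullet> (P *v x k)"] nonneg that by auto
  then have "x k = 0" if "k < m" for k using P[of "x k"] that by fastforce
  then have "b k (axis i 1) = 0" if "k < m" for k i
    using that by (simp add: x_def vec_eq_iff)
  then have "b k v = 0" if "k < m" for k v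
    using linear_eq_0_on_axis[OF b(1)] that by blast
  then show ?thesis by (simp add: b(2))
qed

text \<open>With \<open>y = G\<^sup>-\<^sup>1 x\<close> one has \<open>x \<bullet> G\<^sup>-\<^sup>1 x = G y \<bullet> y\<close>.\<close>

lemma pos_def_matrix_inv:
  fixes G :: "real ^ 'n ^ 'n"
  assumes G: "\<And>x. x \<noteq> 0 \<Longrightarrow> 0 < x \<bullet> (G *v x)" and "x \<noteq> 0"
  shows "0 < x \<bullet> (matrix_inv G *v x)"
proof -
  have "x = 0" if "G *v x = 0" for x using G[of x] that by (cases "x = 0") auto
  then have "invertible G"
    using invertible_left_inverse matrix_left_invertible_ker by blast
  then have "G ** matrix_inv G = mat 1"
    unfolding invertible_def matrix_inv_def by (rule someI2_ex) simp
  then have x: "G *v (matrix_inv G *v x) = x" by (simp add: matrix_vector_mul_assoc)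
  then have "matrix_inv G *v x \<noteq> 0" using \<open>x \<noteq> 0\<close> by auto
  from G[OF this] show ?thesis unfolding x by (simp add: inner_commute)
qed

lemma quadratic_form_gram:
  fixes h :: "real ^ 'n \<Rightarrow> real ^ 'n \<Rightarrow> real"
  assumes "bilinear h"
  shows "((\<chi> i j. h (axis i 1) (axis j 1)) *v y) $ i = h (axis i 1) y"
    "x \<bullet> ((\<chi> i j. h (axis i 1) (axis j 1)) *v y) = h x y"
proof -
  have 1: "((\<chi> i j. h (axis i 1) (axis j 1)) *v y) $ i = h (axis i 1) y" for i
  proof -
    have "linear (h (axis i 1))" using assms by (simp add: bilinear_def)
    then have "h (axis i 1) (\<Sum>j\<in>UNIV. y $ j *\<^sub>R axis j 1) = (\<Sum>j\<in>UNIV. y $ j * h (axis i 1) (axis j 1))"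
      by (simp add: linear_sum linear_cmul)
    moreover have "(\<Sum>j\<in>UNIV. y $ j *\<^sub>R axis j 1) = y"
      using basis_expansion[of y] by (simp add: scalar_mult_eq_scaleR)
    ultimately show ?thesis by (simp add: matrix_vector_mult_def mult.commute)
  qed
  then show "((\<chi> i j. h (axis i 1) (axis j 1)) *v y) $ i = h (axis i 1) y" .
  have lin: "linear (\<lambda>x. h x y)" using assms by (simp add: bilinear_def)
  have "h (\<Sum>i\<in>UNIV. x $ i *\<^sub>R axis i 1) y = (\<Sum>i\<in>UNIV. x $ i * h (axis i 1) y)"
    by (simp add: linear_sum[OF lin] linear_cmul[OF lin])
  moreover have "(\<Sum>j\<in>UNIV. x $ j *\<^sub>R axis j 1) = x"
    using basis_expansion[of x] by (simp add: scalar_mult_eq_scaleR)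
  ultimately show "x \<bullet> ((\<chi> i j. h (axis i 1) (axis j 1)) *v y) = h x y"
    by (simp add: inner_vec_def 1)
qed

lemma pos_def_det_nonzero:
  fixes h :: "real ^ 'n \<Rightarrow> real ^ 'n \<Rightarrow> real"
  assumes "bilinear h" "\<And>v. v \<noteq> 0 \<Longrightarrow> 0 < h v v"
  shows "det (\<chi> i j. h (axis i 1) (axis j 1)) \<noteq> 0"
proof -
  have "x = 0" if "(\<chi> i j. h (axis i 1) (axis j 1)) *v x = 0" for x
    using quadratic_form_gram(2)[OF assms(1), of x x] that assms(2)[of x] by (cases "x = 0") auto
  then show ?thesis
    using invertible_left_inverse matrix_left_invertible_ker invertible_det_nz by blast
qed

lemma pos_def_unique:
  assumes "bilinear h" "\<And>v. v \<noteq> 0 \<Longrightarrow> 0 < (h v v :: real)" "\<And>z. h y z = h y' z"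
  shows "y = y'"
proof -
  have "h (y - y') (y - y') = 0" by (simp add: bilinear_lsub[OF assms(1)] assms(3))
  then show ?thesis using assms(2)[of "y - y'"] by (cases "y = y'") auto
qed

text \<open>The explicit representing vector is what later shows that tangential components depend smoothly on
  the point.\<close>

lemma pos_def_represent_Cramer:
  fixes h :: "real ^ 'n \<Rightarrow> real ^ 'n \<Rightarrow> real"
  assumes h: "bilinear h" "\<And>u v. h u v = h v u" "\<And>v. v \<noteq> 0 \<Longrightarrow> 0 < h v v" and l: "linear l"
  shows "h (\<chi> k. det (\<chi> i j. if j = k then l (axis i 1) else h (axis i 1) (axis j 1))
            / det (\<chi> i j. h (axis i 1) (axis j 1))) z = l z"
    (is "h ?y z = _")
proof -
  have det: "det (\<chi> i j. h (axis i 1) (axis j 1)) \<noteq> 0"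
    using h(1,3) by (rule pos_def_det_nonzero)
  define b :: "real ^ 'n" where "b = (\<chi> i. l (axis i 1))"
  have "(\<chi> i j. h (axis i 1) (axis j 1)) *v ?y = b"
    by (simp only: cramer[OF det] b_def vec_lambda_beta)
  then have *: "h (axis i 1) ?y = l (axis i 1)" for i
    using quadratic_form_gram(1)[OF h(1), of ?y i] by (simp only: b_def vec_lambda_beta)
  have "linear (\<lambda>z. h z ?y - l z)"
    using h(1) l by (intro linear_compose_sub) (simp_all add: bilinear_def)
  from linear_eq_0_on_axis[OF this] have "h z ?y - l z = 0" using * by simp
  then show ?thesis using h(2)[of ?y z] by simp
qed

text \<open>Take \<open>l\<close> to be the maximum of the Rayleigh quotient and \<open>e\<close> a maximiser. Then \<open>l h - A\<close> is
  positive semidefinite with null vector \<open>e\<close>, so \<open>e\<close> lies in its kernel.\<close>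

lemma greatest_eigenvector:
  fixes A h :: "'a::euclidean_space \<Rightarrow> 'a \<Rightarrow> real"
  assumes A: "bilinear A" "\<And>u v. A u v = A v u"
    and h: "bilinear h" "\<And>u v. h u v = h v u" "\<And>v. v \<noteq> 0 \<Longrightarrow> 0 < h v v"
  obtains e l where "e \<noteq> 0" "\<And>v. A e v = l * h e v" "\<And>v. A v v \<le> l * h v v"
proof -
  have cont: "continuous_on (sphere 0 1) (\<lambda>v. B v v)" if "bilinear B" for B :: "'a \<Rightarrow> 'a \<Rightarrow> real"
    using bounded_bilinear.continuous_on[OF _ continuous_on_id continuous_on_id, of B] that
    by (simp add: bilinear_conv_bounded_bilinear)
  have "h v v \<noteq> 0" if "v \<in> sphere 0 1" for v
    using h(3)[of v] that by (cases "v = 0") auto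
  then have "continuous_on (sphere 0 1) (\<lambda>v. A v v / h v v)"
    by (intro continuous_on_divide cont A(1) h(1)) blast
  moreover have "sphere (0::'a) 1 \<noteq> {}" by simp
  ultimately obtain e where e: "e \<in> sphere 0 1" "\<And>v. v \<in> sphere 0 1 \<Longrightarrow> A v v / h v v \<le> A e e / h e e"
    using continuous_attains_sup[OF compact_sphere] by blast
  define l where "l = A e e / h e e"
  have e0: "e \<noteq> 0" using e(1) by auto
  have le: "A v v \<le> l * h v v" for v
  proof (cases "v = 0")
    case True then show ?thesis by (simp add: bilinear_lzero[OF A(1)] bilinear_lzero[OF h(1)])
  next
    case False
    have "A (v /\<^sub>R norm v) (v /\<^sub>R norm v) / h (v /\<^sub>R norm v) (v /\<^sub>R norm v) \<le> l"
      using e(2)[of "v /\<^sub>R norm v"] False by (simp add: l_def)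
    then have "A v v / h v v \<le> l"
      using False by (simp add: bilinear_lmul[OF A(1)] bilinear_rmul[OF A(1)]
          bilinear_lmul[OF h(1)] bilinear_rmul[OF h(1)])
    then show ?thesis using h(3)[OF False] by (simp add: divide_le_eq)
  qed
  have bil: "bilinear (\<lambda>u v. l * h u v - A u v)"
    unfolding bilinear_def
    by (auto intro!: linearI simp: bilinear_ladd[OF A(1)] bilinear_radd[OF A(1)] bilinear_lmul[OF A(1)]
        bilinear_rmul[OF A(1)] bilinear_ladd[OF h(1)] bilinear_radd[OF h(1)] bilinear_lmul[OF h(1)]
        bilinear_rmul[OF h(1)] algebra_simps)
  have sym: "l * h u v - A u v = l * h v u - A v u" for u v
    using A(2)[of u v] h(2)[of u v] by simp
  have null: "l * h e e - A e e = 0" using h(3)[OF e0] by (simp add: l_def)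
  have "l * h e v - A e v = 0" for v
    using psd_form_null_vector[OF bil sym _ null] le by simp
  then show ?thesis using that[OF e0, of l] le by simp
qed

text \<open>The extreme eigenvalues have opposite strict signs: were \<open>A\<close> semidefinite, its vanishing trace
  would force \<open>A = 0\<close>. Eigenvectors of different eigenvalues are orthogonal.\<close>

lemma traceless_form_eigenvectors:
  fixes A h :: "real ^ 'n \<Rightarrow> real ^ 'n \<Rightarrow> real"
  assumes A: "bilinear A" "\<And>u v. A u v = A v u"
    and h: "bilinear h" "\<And>u v. h u v = h v u" "\<And>v. v \<noteq> 0 \<Longrightarrow> 0 < h v v"
    and trace: "(\<Sum>i\<in>UNIV. \<Sum>j\<in>UNIV.
      matrix_inv (\<chi> i j. h (axis i 1) (axis j 1)) $ i $ j * A (axis i 1) (axis j 1)) = 0"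
    and nonzero: "A u v \<noteq> 0"
  obtains e d l m where "e \<noteq> 0" "d \<noteq> 0" "0 < l" "m < 0" "\<And>v. A e v = l * h e v"
    "\<And>v. A d v = m * h d v" "h e d = 0"
proof -
  define P where "P = matrix_inv (\<chi> i j. h (axis i 1) (axis j 1))"
  have P: "0 < x \<bullet> (P *v x)" if "x \<noteq> 0" for x
    unfolding P_def using that h(3)
    by (intro pos_def_matrix_inv) (simp_all add: quadratic_form_gram(2)[OF h(1)])
  have not_nonneg: "\<not> (\<forall>v. 0 \<le> A v v)"
    using psd_form_trace_eq_0[OF A _ P, of u v] trace nonzero unfolding P_def by blast
  have A': "bilinear (\<lambda>u v. - A u v)"
    unfolding bilinear_def
    by (auto intro!: linearI simp: bilinear_ladd[OF A(1)] bilinear_radd[OF A(1)] bilinear_lmul[OF A(1)]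
        bilinear_rmul[OF A(1)])
  have "(\<Sum>i\<in>UNIV. \<Sum>j\<in>UNIV. P $ i $ j * (- A (axis i 1) (axis j 1))) = 0"
    using trace by (simp add: P_def sum_negf)
  then have not_nonpos: "\<not> (\<forall>v. 0 \<le> - A v v)"
    using psd_form_trace_eq_0[OF A' _ _ P, of u v] A(2) nonzero by auto
  obtain e l where e: "e \<noteq> 0" "\<And>v. A e v = l * h e v" "\<And>v. A v v \<le> l * h v v"
    using greatest_eigenvector[OF A h] by blast
  have A'_sym: "- A u v = - A v u" for u v using A(2)[of u v] by simp
  obtain d m where d: "d \<noteq> 0" "\<And>v. - A d v = m * h d v" "\<And>v. - A v v \<le> m * h v v"
    using greatest_eigenvector[OF A' A'_sym h] by blast
  have h_nonneg: "0 \<le> h v v" for v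
    using h(3)[of v] by (cases "v = 0") (auto simp: bilinear_lzero[OF h(1)] less_imp_le)
  have l: "0 < l"
  proof (rule ccontr)
    assume "\<not> 0 < l"
    then have "A v v \<le> 0" for v using e(3)[of v] h_nonneg[of v] mult_nonpos_nonneg[of l "h v v"] by linarith
    then show False using not_nonpos by simp
  qed
  have m: "0 < m"
  proof (rule ccontr)
    assume "\<not> 0 < m"
    then have "0 \<le> A v v" for v using d(3)[of v] h_nonneg[of v] mult_nonpos_nonneg[of m "h v v"] by linarith
    then show False using not_nonneg by simp
  qed
  have "l * h e d = - m * h e d"
    using e(2)[of d] d(2)[of e] A(2)[of e d] h(2)[of e d] by simp
  then have "(l + m) * h e d = 0" by (simp add: algebra_simps)
  then have "h e d = 0" using l m by simp
  then show ?thesis using that[of e d l "- m"] e d l m by (metis add.inverse_inverse mult_minus_left neg_less_0_iff_less)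
qed

text \<open>For a skew map \<open>R\<close> the vectors \<open>R e\<close> and \<open>R d\<close> have, within the plane of \<open>e\<close> and \<open>d\<close>, only the
  component \<open>K = h(R d, e)\<close> and its negative. With \<open>z = e + s d\<close> this gives
  \<open>A(R z, z) = s (l - m) K\<close>, so \<open>K \<noteq> 0\<close> would force \<open>A(z, z) = l h(e, e) + s\<^sup>2 m h(d, d)\<close> to
  vanish for every \<open>s \<noteq> 0\<close>.\<close>

lemma skew_commuting_eigenvectors:
  fixes A h :: "'a::real_vector \<Rightarrow> 'a \<Rightarrow> real"
  assumes A: "bilinear A" "\<And>u v. A u v = A v u"
    and h: "bilinear h" "\<And>u v. h u v = h v u" and d: "0 < h d d"
    and eig: "\<And>v. A e v = l * h e v" "\<And>v. A d v = m * h d v" "h e d = 0"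
    and lm: "0 < l" "m < 0"
    and skew: "\<And>w z. h (R w) z = - h (R z) w"
    and comm: "\<And>z. A (R z) z * A z z = 0"
  shows "h (R d) e = 0"
proof (rule ccontr)
  assume K: "h (R d) e \<noteq> 0"
  have null: "h (R w) w = 0" for w using skew[of w w] by simp
  have *: "l * h e e + s * s * (m * h d d) = 0" if s: "s \<noteq> 0" for s
  proof -
    let ?z = "e + s *\<^sub>R d"
    have "h (R ?z) e = s * h (R d) e"
      using skew[of ?z e] skew[of e d] null[of e] by (simp add: bilinear_radd[OF h(1)] bilinear_rmul[OF h(1)])
    moreover have "h (R ?z) d = - h (R d) e"
      using skew[of ?z d] null[of d] by (simp add: bilinear_radd[OF h(1)] bilinear_rmul[OF h(1)])
    ultimately have "A (R ?z) ?z = s * (l - m) * h (R d) e"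
      using h(2)[of e "R ?z"] h(2)[of d "R ?z"] A(2)[of "R ?z" ?z]
      by (simp add: bilinear_ladd[OF A(1)] bilinear_lmul[OF A(1)] eig algebra_simps)
    then have "A ?z ?z = 0" using comm[of ?z] K s lm by simp
    then show ?thesis
      using eig(3) h(2)[of d e]
      by (simp add: bilinear_ladd[OF A(1)] bilinear_lmul[OF A(1)] eig bilinear_radd[OF h(1)]
          bilinear_rmul[OF h(1)] algebra_simps)
  qed
  \<comment> \<open>two values of \<open>s\<close> with different squares separate the two terms\<close>
  have "m * h d d = 0"
  proof -
    have "l * h e e + m * h d d = 0" "l * h e e + 4 * (m * h d d) = 0"
      using *[of 1] *[of 2] by simp_all
    then show ?thesis by linarith
  qed
  then show False using d lm by simp
qed

section \<open>Spacelike immersions and their Gauss equation\<close>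

text \<open>The assumptions on \<open>g\<close> and \<open>cov_along g f\<close> are those properties of a semi-Riemannian metric and
  its Levi-Civita connection, pulled back along \<open>f\<close>, on which submanifold theory rests. Stated for
  fields along \<open>f\<close>, they can be checked for a concrete metric by differentiating its components.\<close>

locale spacelike_immersion =
  fixes g :: "('e::euclidean_space) metric" and f :: "real ^ 'n \<Rightarrow> 'e" and S :: "(real ^ 'n) set"
  assumes open_S: "open S"
    and smooth_f: "smooth_on S f"
    and metric_bilinear: "\<And>p. p \<in> S \<Longrightarrow> bilinear (g (f p))"
    and metric_sym: "\<And>p X Y. p \<in> S \<Longrightarrow> g (f p) X Y = g (f p) Y X"
    and pos_def: "\<And>p v. p \<in> S \<Longrightarrow> v \<noteq> 0 \<Longrightarrow> 0 < g (f p) (ddir f p v) (ddir f p v)"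
    and smooth_metric: "\<And>V W. smooth_on S V \<Longrightarrow> smooth_on S W \<Longrightarrow> smooth_on S (\<lambda>p. g (f p) (V p) (W p))"
    and smooth_cov: "\<And>u V. smooth_on S V \<Longrightarrow> smooth_on S (\<lambda>p. cov_along g f p u V)"
    and linear_cov: "\<And>p V. p \<in> S \<Longrightarrow> smooth_on S V \<Longrightarrow> linear (\<lambda>u. cov_along g f p u V)"
    and metric_compatible: "\<And>p u V W. p \<in> S \<Longrightarrow> smooth_on S V \<Longrightarrow> smooth_on S W \<Longrightarrow>
      ddir (\<lambda>q. g (f q) (V q) (W q)) p u =
        g (f p) (cov_along g f p u V) (W p) + g (f p) (V p) (cov_along g f p u W)"
    and torsion_free: "\<And>p u v. p \<in> S \<Longrightarrow>
      cov_along g f p u (\<lambda>q. ddir f q v) = cov_along g f p v (\<lambda>q. ddir f q u)"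
begin

abbreviation "h \<equiv> induced_metric g f"

abbreviation "nabla \<equiv> cov_along g f"

abbreviation "coord v \<equiv> (\<lambda>q. ddir f q v)"

abbreviation "normal p X \<equiv> (\<forall>z. g (f p) X (ddir f p z) = 0)"

definition tangent_coord :: "real ^ 'n \<Rightarrow> 'e \<Rightarrow> real ^ 'n" where
  "tangent_coord p X = (THE y. \<forall>z. h p y z = g (f p) X (ddir f p z))"

lemma cov_cong:
  assumes "p \<in> S" "\<And>q. q \<in> S \<Longrightarrow> V q = W q"
  shows "nabla p u V = nabla p u W"
  using ddir_cong_open[OF open_S assms(1), of V W] assms by (simp add: cov_along_def)

lemma linear_coord: "p \<in> S \<Longrightarrow> linear (ddir f p)"
  by (rule linear_ddir[OF smooth_f])

lemma smooth_coord: "smooth_on S (coord v)"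
  by (rule smooth_on_ddir[OF smooth_f])

lemma linear_metric:
  assumes "p \<in> S"
  shows "linear (\<lambda>X. g (f p) X Y)" "linear (\<lambda>Y. g (f p) X Y)"
  using metric_bilinear[OF assms] by (simp_all add: bilinear_def)

lemma bilinear_h: "p \<in> S \<Longrightarrow> bilinear (h p)"
  unfolding bilinear_def induced_metric_def
  using linear_compose[OF linear_coord linear_metric(1)] linear_compose[OF linear_coord linear_metric(2)]
  by (auto simp: o_def)

lemma h_sym: "p \<in> S \<Longrightarrow> h p u v = h p v u"
  by (simp add: induced_metric_def metric_sym)

lemma h_pos: "p \<in> S \<Longrightarrow> v \<noteq> 0 \<Longrightarrow> 0 < h p v v"
  by (simp add: induced_metric_def pos_def)

lemma smooth_h: "smooth_on S (\<lambda>p. h p u v)"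
  unfolding induced_metric_def by (intro smooth_metric smooth_coord)

lemma h_unique: "p \<in> S \<Longrightarrow> (\<And>z. h p y z = h p y' z) \<Longrightarrow> y = y'"
  using pos_def_unique[OF bilinear_h h_pos] by blast

lemma linear_metric_coord:
  assumes "p \<in> S" shows "linear (\<lambda>z. g (f p) X (ddir f p z))"
  using linear_compose[OF linear_coord[OF assms] linear_metric(2)[OF assms]] by (simp add: o_def)

text \<open>The tangential component is determined by its scalar products with tangent vectors; solving the
  Gram system by Cramer's rule gives existence together with a formula that is manifestly smooth.\<close>

lemma
  assumes p: "p \<in> S"
  shows tangent_coord_Cramer: "tangent_coord p X =
      (\<chi> k. det (\<chi> i j. if j = k then g (f p) X (ddir f p (axis i 1)) else h p (axis i 1) (axis j 1))
            / det (\<chi> i j. h p (axis i 1) (axis j 1)))" (is "_ = ?y")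
    and h_tangent_coord: "h p (tangent_coord p X) z = g (f p) X (ddir f p z)"
proof -
  have y: "\<forall>z. h p ?y z = g (f p) X (ddir f p z)"
    using pos_def_represent_Cramer[OF bilinear_h[OF p] h_sym[OF p] h_pos[OF p] linear_metric_coord[OF p]]
    by blast
  show eq: "tangent_coord p X = ?y"
    unfolding tangent_coord_def
  proof (rule the_equality[of _ ?y])
    show "\<forall>z. h p ?y z = g (f p) X (ddir f p z)" by (rule y)
    show "y = ?y" if "\<forall>z. h p y z = g (f p) X (ddir f p z)" for y
      using that y by (intro h_unique[OF p]) metis
  qed
  show "h p (tangent_coord p X) z = g (f p) X (ddir f p z)"
    unfolding eq using y by blast
qed

lemma tangent_coord_eqI:
  "p \<in> S \<Longrightarrow> (\<And>z. h p y z = g (f p) X (ddir f p z)) \<Longrightarrow> tangent_coord p X = y"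
  using h_unique[of p "tangent_coord p X" y] h_tangent_coord[of p X] by simp

lemma linear_tangent_coord:
  assumes p: "p \<in> S" shows "linear (tangent_coord p)"
proof (rule linearI)
  note B = bilinear_ladd[OF bilinear_h[OF p]] bilinear_lmul[OF bilinear_h[OF p]]
    bilinear_ladd[OF metric_bilinear[OF p]] bilinear_lmul[OF metric_bilinear[OF p]]
  show "tangent_coord p (X + Y) = tangent_coord p X + tangent_coord p Y" for X Y
    by (rule tangent_coord_eqI[OF p]) (simp add: B h_tangent_coord[OF p])
  show "tangent_coord p (c *\<^sub>R X) = c *\<^sub>R tangent_coord p X" for c X
    by (rule tangent_coord_eqI[OF p]) (simp add: B h_tangent_coord[OF p])
qed

lemma smooth_tangent_coord:
  assumes V: "smooth_on S V"
  shows "smooth_on S (\<lambda>p. tangent_coord p (V p))"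
proof -
  have 1: "smooth_on S (\<lambda>p. det (\<chi> i j. h p (axis i 1) (axis j 1)))"
    by (intro smooth_on_det[OF open_S]) (simp add: smooth_h)
  have 2: "smooth_on S (\<lambda>p. inverse (det (\<chi> i j. h p (axis i 1) (axis j 1))))"
    by (intro smooth_on_inverse[OF open_S 1] pos_def_det_nonzero bilinear_h h_pos)
  have 3: "smooth_on S (\<lambda>p. det (\<chi> i j. if j = k then g (f p) (V p) (ddir f p (axis i 1)) else h p (axis i 1) (axis j 1)))"
    for k
  proof (rule smooth_on_det[OF open_S])
    fix i j
    show "smooth_on S (\<lambda>p. (\<chi> i j. if j = k then g (f p) (V p) (ddir f p (axis i 1))
        else h p (axis i 1) (axis j 1)) $ i $ j)"
      by (cases "j = k") (simp_all add: smooth_h smooth_metric[OF V smooth_coord])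
  qed
  have "smooth_on S (\<lambda>p. \<chi> k. det (\<chi> i j. if j = k then g (f p) (V p) (ddir f p (axis i 1)) else h p (axis i 1) (axis j 1))
            * inverse (det (\<chi> i j. h p (axis i 1) (axis j 1))))"
    by (intro smooth_on_vec[OF open_S] smooth_on_mult[OF open_S] 2 3)
  then show ?thesis
    using smooth_on_cong[OF open_S, of "\<lambda>p. tangent_coord p (V p)"] tangent_coord_Cramer
    by (simp add: divide_inverse)
qed

lemma normal_part_eq:
  assumes p: "p \<in> S"
  shows "normal_part g f p X = X - ddir f p (tangent_coord p X)"
  unfolding normal_part_def
proof (rule the_equality)
  note lin = bilinear_lsub[OF metric_bilinear[OF p]]
  show "normal p (X - ddir f p (tangent_coord p X)) \<and>
      X - (X - ddir f p (tangent_coord p X)) \<in> range (ddir f p)"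
    using h_tangent_coord[OF p, of X] by (simp add: lin induced_metric_def)
  fix Y assume Y: "normal p Y \<and> X - Y \<in> range (ddir f p)"
  then obtain y where y: "X - Y = ddir f p y" by blast
  have "tangent_coord p X = y"
    using Y by (intro tangent_coord_eqI[OF p]) (simp add: induced_metric_def flip: y add: lin)
  then show "Y = X - ddir f p (tangent_coord p X)" using y by (simp add: algebra_simps)
qed

lemma normal_normal_part: "p \<in> S \<Longrightarrow> g (f p) (normal_part g f p X) (ddir f p z) = 0"
  using h_tangent_coord[of p X]
  by (simp add: normal_part_eq bilinear_lsub[OF metric_bilinear] induced_metric_def)

lemma normal_part_of_normal:
  assumes p: "p \<in> S" and N: "normal p N"
  shows "normal_part g f p N = N"
proof -
  have "tangent_coord p N = 0"
    using N by (intro tangent_coord_eqI[OF p]) (simp add: bilinear_lzero[OF bilinear_h[OF p]])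
  then show ?thesis using linear_0[OF linear_coord[OF p]] by (simp add: normal_part_eq[OF p])
qed

lemma metric_normal_part:
  assumes p: "p \<in> S" and N: "normal p N"
  shows "g (f p) (normal_part g f p X) N = g (f p) X N"
proof -
  have "g (f p) (ddir f p z) N = 0" for z using N metric_sym[OF p, of "ddir f p z" N] by simp
  then show ?thesis by (simp add: normal_part_eq[OF p] bilinear_lsub[OF metric_bilinear[OF p]])
qed

lemma linear_normal_part:
  assumes p: "p \<in> S" shows "linear (normal_part g f p)"
proof -
  have "normal_part g f p = (\<lambda>X. X - ddir f p (tangent_coord p X))"
    by (rule ext) (rule normal_part_eq[OF p])
  then show ?thesis
    using linear_compose_sub[OF linear_ident linear_compose[OF linear_tangent_coord[OF p] linear_coord[OF p]]]
    by (simp add: o_def)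
qed

lemma smooth_normal_part:
  assumes V: "smooth_on S V"
  shows "smooth_on S (\<lambda>p. normal_part g f p (V p))"
proof -
  have "smooth_on S (\<lambda>p. V p - ddir f p (tangent_coord p (V p)))"
    by (intro smooth_on_diff[OF open_S V]
        smooth_on_linear_field[OF open_S linear_coord smooth_coord smooth_tangent_coord[OF V]])
  then show ?thesis
    using smooth_on_cong[OF open_S, of "\<lambda>p. normal_part g f p (V p)"] normal_part_eq by simp
qed

lemma second_ff_sym: "p \<in> S \<Longrightarrow> second_ff g f p u v = second_ff g f p v u"
  by (simp add: second_ff_def torsion_free[of p u v])

lemma linear_second_ff:
  assumes p: "p \<in> S"
  shows "linear (\<lambda>u. second_ff g f p u v)" "linear (second_ff g f p u)"
proof -
  show 1: "linear (\<lambda>u. second_ff g f p u v)" for v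
    using linear_compose[OF linear_cov[OF p smooth_coord] linear_normal_part[OF p]]
    by (simp add: second_ff_def o_def)
  show "linear (second_ff g f p u)"
    using 1[of u] second_ff_sym[OF p, of u] by presburger
qed

lemma normal_second_ff: "p \<in> S \<Longrightarrow> g (f p) (second_ff g f p u v) (ddir f p z) = 0"
  by (simp add: second_ff_def normal_normal_part)

lemma smooth_second_ff: "smooth_on S (\<lambda>p. second_ff g f p u v)"
  unfolding second_ff_def by (intro smooth_normal_part smooth_cov smooth_coord)

text \<open>The Koszul formula for the induced metric: metric compatibility and symmetry of the ambient
  connection make four of the six terms cancel.\<close>

lemma christoffel_induced:
  assumes p: "p \<in> S"
  shows "christoffel h p u v = tangent_coord p (nabla p u (coord v))"
proof -
  have D: "ddir (\<lambda>q. h q v z) p u =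
      g (f p) (nabla p u (coord v)) (ddir f p z) + g (f p) (ddir f p v) (nabla p u (coord z))" for u v z
    unfolding induced_metric_def by (rule metric_compatible[OF p smooth_coord smooth_coord])
  have "ddir (\<lambda>q. h q v z) p u + ddir (\<lambda>q. h q u z) p v - ddir (\<lambda>q. h q u v) p z =
      2 * g (f p) (nabla p u (coord v)) (ddir f p z)" for z
    unfolding D
    using torsion_free[OF p, of u v] torsion_free[OF p, of u z] torsion_free[OF p, of v z]
      metric_sym[OF p, of "ddir f p u"] metric_sym[OF p, of "ddir f p v"] by simp
  then show ?thesis by (simp add: christoffel_def tangent_coord_def)
qed

lemma smooth_christoffel: "smooth_on S (\<lambda>q. christoffel h q u v)"
  using smooth_on_cong[OF open_S, of "\<lambda>q. christoffel h q u v" "\<lambda>q. tangent_coord q (nabla q u (coord v))"]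
    smooth_tangent_coord[OF smooth_cov[OF smooth_coord]] christoffel_induced by simp

lemma h_christoffel:
  "p \<in> S \<Longrightarrow> h p (christoffel h p u v) z = g (f p) (nabla p u (coord v)) (ddir f p z)"
  by (simp add: christoffel_induced h_tangent_coord)

lemma second_ff_eq:
  "p \<in> S \<Longrightarrow> second_ff g f p u v = nabla p u (coord v) - ddir f p (christoffel h p u v)"
  by (simp add: second_ff_def normal_part_eq christoffel_induced)

text \<open>Half of the Gauss equation. The defining relation \<open>h(\<Gamma>(v, w), z) = g(\<nabla>\<^sub>v f\<^sub>w, f\<^sub>z)\<close> is
  differentiated in direction \<open>u\<close>. The terms containing \<open>\<nabla>\<^sub>u f\<^sub>z\<close> combine to
  \<open>g(\<nabla>\<^sub>v f\<^sub>w - f\<^sub>* \<Gamma>(v, w), \<nabla>\<^sub>u f\<^sub>z)\<close>, whose first entry is the normal vector \<open>\<alpha>(v, w)\<close>.\<close>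

lemma h_second_cov_deriv:
  assumes p: "p \<in> S"
  shows "h p (cov_deriv h p u (\<lambda>q. cov_deriv h q v (\<lambda>_. w))) z =
      g (f p) (nabla p u (\<lambda>q. nabla q v (coord w))) (ddir f p z) +
      g (f p) (second_ff g f p v w) (second_ff g f p u z)"
proof -
  define Y where "Y = (\<lambda>q. christoffel h q v w)"
  define X where "X = (\<lambda>q. nabla q v (coord w))"
  have smY: "smooth_on S Y" and smX: "smooth_on S X"
    unfolding X_def Y_def by (intro smooth_christoffel smooth_cov smooth_coord)+
  have linh: "linear (\<lambda>y. h q y z)" if "q \<in> S" for q
    using bilinear_h[OF that] by (simp add: bilinear_def)
  have "ddir (\<lambda>q. h q (Y q) z) p u = ddir (\<lambda>q. g (f q) (X q) (coord z q)) p u"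
    using ddir_cong_open[OF open_S p, of "\<lambda>q. h q (Y q) z" "\<lambda>q. g (f q) (X q) (coord z q)"]
    by (simp add: X_def Y_def h_christoffel)
  also have "\<dots> = g (f p) (nabla p u X) (ddir f p z) + g (f p) (X p) (nabla p u (coord z))"
    by (rule metric_compatible[OF p smX smooth_coord])
  finally have "ddir (\<lambda>q. h q (Y p) z) p u + h p (ddir Y p u) z =
      g (f p) (nabla p u X) (ddir f p z) + g (f p) (X p) (nabla p u (coord z))"
    using ddir_linear_field[OF open_S linh smooth_h smY p] by simp
  moreover have "ddir (\<lambda>q. h q (Y p) z) p u =
      h p (christoffel h p u (Y p)) z + g (f p) (ddir f p (Y p)) (nabla p u (coord z))"
    unfolding induced_metric_def metric_compatible[OF p smooth_coord smooth_coord]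
    by (simp add: h_christoffel[OF p] flip: induced_metric_def)
  moreover have "g (f p) (second_ff g f p v w) (second_ff g f p u z) =
      g (f p) (X p) (nabla p u (coord z)) - g (f p) (ddir f p (Y p)) (nabla p u (coord z))"
  proof -
    have "g (f p) (second_ff g f p v w) (second_ff g f p u z) =
        g (f p) (second_ff g f p v w) (nabla p u (coord z))"
      using metric_normal_part[OF p, of "second_ff g f p v w"] normal_second_ff[OF p]
        metric_sym[OF p] by (simp add: second_ff_def)
    then show ?thesis
      by (simp add: second_ff_eq[OF p] X_def Y_def bilinear_lsub[OF metric_bilinear[OF p]])
  qed
  moreover have "cov_deriv h p u (\<lambda>q. cov_deriv h q v (\<lambda>_. w)) = ddir Y p u + christoffel h p u (Y p)"
    by (simp add: cov_deriv_def Y_def)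
  ultimately show ?thesis
    using bilinear_ladd[OF bilinear_h[OF p]] by (simp add: X_def)
qed

text \<open>The ambient curvature \<open>R(f\<^sub>u, f\<^sub>v)f\<^sub>w\<close>, written with the pulled back connection only; the bracket
  term vanishes for coordinate fields.\<close>

definition ambient_curv :: "real ^ 'n \<Rightarrow> real ^ 'n \<Rightarrow> real ^ 'n \<Rightarrow> real ^ 'n \<Rightarrow> 'e" where
  "ambient_curv p u v w =
     nabla p u (\<lambda>q. nabla q v (coord w)) - nabla p v (\<lambda>q. nabla q u (coord w))"

theorem Gauss_equation:
  assumes p: "p \<in> S"
  shows "h p (riemann h p u v w) z = g (f p) (ambient_curv p u v w) (ddir f p z) +
      g (f p) (second_ff g f p v w) (second_ff g f p u z) -
      g (f p) (second_ff g f p u w) (second_ff g f p v z)"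
  unfolding riemann_def ambient_curv_def
  by (simp add: bilinear_lsub[OF bilinear_h[OF p]] bilinear_lsub[OF metric_bilinear[OF p]]
      h_second_cov_deriv[OF p])

text \<open>Skewness of the normal curvature is the commutation of the second derivatives of the function
  \<open>g(\<xi>, \<xi>)\<close>: its mixed derivative is \<open>2 g(\<nabla>\<^sup>\<bottom>\<^sub>u \<nabla>\<^sup>\<bottom>\<^sub>v \<xi>, \<xi>)\<close> plus a
  term symmetric in \<open>u\<close> and \<open>v\<close>.\<close>

theorem normal_curv_skew:
  assumes p: "p \<in> S" and sm: "smooth_on S \<xi>" and N: "\<And>q. q \<in> S \<Longrightarrow> normal q (\<xi> q)"
  shows "g (f p) (normal_curv g f p u v \<xi>) (\<xi> p) = 0"
proof -
  define \<phi> where "\<phi> = (\<lambda>q. g (f q) (\<xi> q) (\<xi> q))"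
  have sm\<phi>: "smooth_on S \<phi>" unfolding \<phi>_def by (intro smooth_metric sm)
  have sm\<eta>: "smooth_on S (\<lambda>q. normal_cov g f q v \<xi>)" for v
    unfolding normal_cov_def by (intro smooth_normal_part smooth_cov sm)
  have cov: "g (f q) (nabla q v \<zeta>) (\<xi> q) = g (f q) (normal_cov g f q v \<zeta>) (\<xi> q)" if "q \<in> S" for q v \<zeta>
    using metric_normal_part[OF that N[OF that]] by (simp add: normal_cov_def)
  have D1: "ddir \<phi> q v = 2 * g (f q) (normal_cov g f q v \<xi>) (\<xi> q)" if "q \<in> S" for q v
    unfolding \<phi>_def metric_compatible[OF that sm sm]
    using cov[OF that] metric_sym[OF that, of "\<xi> q"] by simp
  have D2: "ddir (\<lambda>q. ddir \<phi> q v) p u = 2 * (g (f p) (normal_cov g f p u (\<lambda>q. normal_cov g f q v \<xi>)) (\<xi> p) +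
      g (f p) (normal_cov g f p v \<xi>) (normal_cov g f p u \<xi>))" for u v
  proof -
    have "ddir (\<lambda>q. ddir \<phi> q v) p u = ddir (\<lambda>q. 2 * g (f q) (normal_cov g f q v \<xi>) (\<xi> q)) p u"
      using ddir_cong_open[OF open_S p, of "\<lambda>q. ddir \<phi> q v"] D1 by simp
    also have "\<dots> = 2 * ddir (\<lambda>q. g (f q) (normal_cov g f q v \<xi>) (\<xi> q)) p u"
      by (rule ddir_bounded_linear[OF bounded_linear_mult_right smooth_metric[OF sm\<eta> sm] p])
    also have "ddir (\<lambda>q. g (f q) (normal_cov g f q v \<xi>) (\<xi> q)) p u =
        g (f p) (normal_cov g f p u (\<lambda>q. normal_cov g f q v \<xi>)) (\<xi> p) +
        g (f p) (normal_cov g f p v \<xi>) (nabla p u \<xi>)"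
      unfolding metric_compatible[OF p sm\<eta> sm] cov[OF p] by (rule refl)
    also have "g (f p) (normal_cov g f p v \<xi>) (nabla p u \<xi>) =
        g (f p) (normal_cov g f p v \<xi>) (normal_cov g f p u \<xi>)"
      using metric_normal_part[OF p, of "normal_cov g f p v \<xi>" "nabla p u \<xi>"] normal_normal_part[OF p]
        metric_sym[OF p, of "normal_cov g f p v \<xi>" "nabla p u \<xi>"]
        metric_sym[OF p, of "normal_cov g f p v \<xi>" "normal_cov g f p u \<xi>"]
      by (simp add: normal_cov_def)
    finally show ?thesis .
  qed
  show ?thesis
    using ddir_commute[OF open_S sm\<phi> p, of v u] D2[of u v] D2[of v u]
      metric_sym[OF p, of "normal_cov g f p v \<xi>" "normal_cov g f p u \<xi>"]
    by (simp add: normal_curv_def bilinear_lsub[OF metric_bilinear[OF p]])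
qed

text \<open>By symmetry of \<open>\<alpha>\<close>, the condition on the pair \<open>(z, z)\<close> says that the normal curvature applied to
  \<open>\<alpha>(z, z)\<close> equals \<open>2 \<alpha>(R(x, y)z, z)\<close>. Being skew, it is orthogonal to \<open>\<alpha>(z, z)\<close>.\<close>

theorem semi_parallel_second_ff:
  assumes p: "p \<in> S" and sp: "curv_dot_sff g f p x y z z = 0"
  shows "g (f p) (second_ff g f p (riemann h p x y z) z) (second_ff g f p z z) = 0"
proof -
  have "normal_curv g f p x y (\<lambda>q. second_ff g f q z z) = 2 *\<^sub>R second_ff g f p (riemann h p x y z) z"
    using sp second_ff_sym[OF p, of z] by (simp add: curv_dot_sff_def scaleR_2 algebra_simps)
  then have "g (f p) (2 *\<^sub>R second_ff g f p (riemann h p x y z) z) (second_ff g f p z z) = 0"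
    using normal_curv_skew[OF p smooth_second_ff, of z z x y] normal_second_ff by simp
  then show ?thesis by (simp add: bilinear_lmul[OF metric_bilinear[OF p]])
qed

text \<open>The Codazzi equation in the totally geodesic case. Extend \<open>N\<close> to a normal field \<open>\<nu>\<close>.
  Both \<open>f\<^sub>y\<close> and \<open>\<nabla>\<^sub>v f\<^sub>w\<close> are tangent, hence orthogonal to \<open>\<nu>\<close>; differentiating the first relation
  shows that \<open>\<nabla>\<^sub>u \<nu>\<close> is normal, and differentiating the second one then shows that
  \<open>\<nabla>\<^sub>u \<nabla>\<^sub>v f\<^sub>w\<close> is tangent at \<open>p\<close>.\<close>

theorem totally_geodesic_ambient_curv:
  assumes p: "p \<in> S" and tg: "\<And>q u v. q \<in> S \<Longrightarrow> second_ff g f q u v = 0" and N: "normal p N"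
  shows "g (f p) (ambient_curv p u v w) N = 0"
proof -
  define \<nu> where "\<nu> = (\<lambda>q. normal_part g f q N)"
  have sm\<nu>: "smooth_on S \<nu>" unfolding \<nu>_def by (intro smooth_normal_part smooth_on_const)
  have \<nu>p: "\<nu> p = N" unfolding \<nu>_def by (rule normal_part_of_normal[OF p N])
  have tan: "nabla q v (coord w) = ddir f q (christoffel h q v w)" if "q \<in> S" for q v w
    using second_ff_eq[OF that] tg[OF that] by simp
  have orth: "g (f q) (ddir f q y) (\<nu> q) = 0" if "q \<in> S" for q y
    using normal_normal_part[OF that] metric_sym[OF that] by (simp add: \<nu>_def)
  have "ddir (\<lambda>q. g (f q) (coord y q) (\<nu> q)) p u = 0" for u y
    using ddir_cong_open[OF open_S p, of "\<lambda>q. g (f q) (coord y q) (\<nu> q)" "\<lambda>_. 0"] orth by simp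
  then have cov\<nu>: "g (f p) (ddir f p y) (nabla p u \<nu>) = 0" for u y
    unfolding metric_compatible[OF p smooth_coord sm\<nu>] tan[OF p] orth[OF p] by simp
  have "ddir (\<lambda>q. g (f q) (nabla q v (coord w)) (\<nu> q)) p u = 0" for u v
    using ddir_cong_open[OF open_S p, of "\<lambda>q. g (f q) (nabla q v (coord w)) (\<nu> q)" "\<lambda>_. 0"] orth tan by simp
  then have "g (f p) (nabla p u (\<lambda>q. nabla q v (coord w))) N = 0" for u v
    unfolding metric_compatible[OF p smooth_cov[OF smooth_coord] sm\<nu>] \<nu>p unfolding tan[OF p] cov\<nu> by simp
  then show ?thesis by (simp add: ambient_curv_def bilinear_lsub[OF metric_bilinear[OF p]])
qed

end

section \<open>Einstein-de Sitter spacetime\<close>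

lemma eds_metric_eq:
  assumes "0 < t"
  shows "eds_metric (t, x) X Y = - (fst X * fst Y) + t powr (2 / 3) * (snd X \<bullet> snd Y)"
  using assms
  by (simp add: eds_metric_def lorentzian_warped_metric_def case_prod_beta powr_powr flip: powr_numeral)

text \<open>Reduces the powers of \<open>t\<close> that occur to \<open>t\<close> and \<open>t powr (- (1 / 3))\<close>, in which the
  curvature identities become polynomial.\<close>

lemma eds_powr:
  assumes "0 < (t::real)"
  shows "t powr (2 / 3) = t * t powr (- (1 / 3))" "t powr (- (4 / 3)) = t powr (- (1 / 3)) / t"
    "t powr (- 1) = 1 / t" "t powr (- 2) = 1 / t / t"
proof -
  show "t powr (2 / 3) = t * t powr (- (1 / 3))"
    using powr_add[of t 1 "- (1 / 3)"] assms by simp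
  show "t powr (- (4 / 3)) = t powr (- (1 / 3)) / t"
    using powr_diff[of t "- (1 / 3)" 1] assms by simp
  show "t powr (- 1) = 1 / t" using assms by (simp add: powr_minus_divide)
  show "t powr (- 2) = 1 / t / t"
    using assms by (simp add: powr_minus_divide power2_eq_square)
qed

lemma bilinear_eds_metric: "bilinear (eds_metric q)"
  unfolding bilinear_def eds_metric_def lorentzian_warped_metric_def
  by (auto intro!: linearI simp: case_prod_beta inner_add_left inner_add_right algebra_simps)

lemma eds_metric_sym: "eds_metric q X Y = eds_metric q Y X"
  by (simp add: eds_metric_def lorentzian_warped_metric_def case_prod_beta inner_commute)

lemma eds_metric_nondegenerate:
  fixes X :: "real \<times> (real ^ 'n)"
  assumes t: "0 < t" and eq: "\<And>Z. eds_metric (t, x) X Z = eds_metric (t, x) Y Z"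
  shows "X = Y"
proof -
  have "fst X = fst Y" using eq[of "(1, 0)"] by (simp add: eds_metric_eq[OF t])
  moreover have "snd X \<bullet> z = snd Y \<bullet> z" for z
    using eq[of "(0, z)"] t by (simp add: eds_metric_eq[OF t])
  then have "snd X = snd Y" using vector_eq_rdot by blast
  ultimately show ?thesis by (rule prod_eqI)
qed

lemma ddir_eds_metric:
  assumes t: "0 < t"
  shows "ddir (\<lambda>q. eds_metric q V Z) (t, x) U = 2 / 3 * t powr (- (1 / 3)) * fst U * (snd V \<bullet> snd Z)"
proof -
  have "((\<lambda>q. eds_metric q V Z) has_derivative (\<lambda>U. 2 / 3 * t powr (- (1 / 3)) * fst U * (snd V \<bullet> snd Z))) (at (t, x))"
  proof (rule has_derivative_transform_within_open)
    have "((\<lambda>s. s powr (2 / 3)) has_derivative (\<lambda>s. 2 / 3 * t powr (- (1 / 3)) * s)) (at t)"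
      using has_real_derivative_powr[OF t, of "2 / 3"] unfolding has_field_derivative_def
      by (rule has_derivative_eq_rhs) (simp add: fun_eq_iff)
    then have "((\<lambda>q. fst q powr (2 / 3)) has_derivative (\<lambda>U. 2 / 3 * t powr (- (1 / 3)) * fst U)) (at (t, x))"
      using has_derivative_compose[OF bounded_linear_imp_has_derivative[OF bounded_linear_fst], of
          "\<lambda>s. s powr (2 / 3)" _ "(t, x)"] by simp
    from has_derivative_add[OF has_derivative_const[of "- (fst V * fst Z)"]
        bounded_linear.has_derivative[OF bounded_linear_mult_left[of "snd V \<bullet> snd Z"] this]]
    show "((\<lambda>q. - (fst V * fst Z) + fst q powr (2 / 3) * (snd V \<bullet> snd Z)) has_derivative
        (\<lambda>U. 2 / 3 * t powr (- (1 / 3)) * fst U * (snd V \<bullet> snd Z))) (at (t, x))"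
      by simp
    show "open ({0::real<..} \<times> (UNIV :: (real ^ 'b) set))" by (intro open_Times) auto
    show "(t, x) \<in> {0<..} \<times> UNIV" using t by simp
    show "- (fst V * fst Z) + fst q powr (2 / 3) * (snd V \<bullet> snd Z) = eds_metric q V Z"
      if "q \<in> {0<..} \<times> UNIV" for q
      using that eds_metric_eq[of "fst q" "snd q" V Z] by (simp add: mem_Times_iff)
  qed
  then show ?thesis by (rule ddir_eqI)
qed

lemma christoffel_eds:
  assumes t: "0 < t"
  shows "christoffel eds_metric (t, x) U V =
    (1 / 3 * t powr (- (1 / 3)) * (snd U \<bullet> snd V), (1 / (3 * t)) *\<^sub>R (fst U *\<^sub>R snd V + fst V *\<^sub>R snd U))"
    (is "_ = ?W")
proof -
  have W: "2 * eds_metric (t, x) ?W Z = ddir (\<lambda>q. eds_metric q V Z) (t, x) U +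
      ddir (\<lambda>q. eds_metric q U Z) (t, x) V - ddir (\<lambda>q. eds_metric q U V) (t, x) Z" for Z
    using t unfolding ddir_eds_metric[OF t] eds_metric_eq[OF t] eds_powr(1)[OF t]
    by (simp add: inner_add_left field_simps)
  show ?thesis
    unfolding christoffel_def
  proof (rule the_equality)
    show "\<forall>Z. 2 * eds_metric (t, x) ?W Z = ddir (\<lambda>q. eds_metric q V Z) (t, x) U +
      ddir (\<lambda>q. eds_metric q U Z) (t, x) V - ddir (\<lambda>q. eds_metric q U V) (t, x) Z"
      using W by blast
    fix W' assume W': "\<forall>Z. 2 * eds_metric (t, x) W' Z = ddir (\<lambda>q. eds_metric q V Z) (t, x) U +
      ddir (\<lambda>q. eds_metric q U Z) (t, x) V - ddir (\<lambda>q. eds_metric q U V) (t, x) Z"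
    show "W' = ?W"
      by (rule eds_metric_nondegenerate[OF t, of x]) (use W W' in \<open>metis mult_left_cancel zero_neq_numeral\<close>)
  qed
qed

text \<open>In the application \<open>f\<close> is the immersion precomposed with the inverse of a chart, and \<open>S\<close> is the image
  of the chart.\<close>

locale eds_immersion =
  fixes f :: "real ^ 'n \<Rightarrow> real \<times> (real ^ 'n)" and S :: "(real ^ 'n) set"
  assumes open_S: "open S" and smooth_f: "smooth_on S f"
    and in_eds: "\<And>p. p \<in> S \<Longrightarrow> f p \<in> eds_spacetime"
    and pos_def: "\<And>p v. p \<in> S \<Longrightarrow> v \<noteq> 0 \<Longrightarrow> 0 < induced_metric eds_metric f p v v"
begin

abbreviation "\<tau> \<equiv> \<lambda>p. fst (f p)"

abbreviation "\<xi> \<equiv> \<lambda>p. snd (f p)"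

lemma time_pos: "p \<in> S \<Longrightarrow> 0 < \<tau> p"
  using in_eds[of p] by (auto simp: eds_spacetime_def)

lemma smooth_time: "smooth_on S \<tau>" and smooth_space: "smooth_on S \<xi>"
  using smooth_on_fst[OF open_S smooth_f] smooth_on_snd[OF open_S smooth_f] by auto

lemma ddir_f: "p \<in> S \<Longrightarrow> ddir f p u = (ddir \<tau> p u, ddir \<xi> p u)"
  using ddir_fst[OF smooth_f] ddir_snd[OF smooth_f] by (metis prod.collapse)

lemma metric_eq:
  "p \<in> S \<Longrightarrow> eds_metric (f p) X Y = - (fst X * fst Y) + \<tau> p powr (2 / 3) * (snd X \<bullet> snd Y)"
  using eds_metric_eq[OF time_pos, of p "\<xi> p"] by simp

lemma cov_along_eds:
  assumes p: "p \<in> S" and V: "smooth_on S V"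
  shows "cov_along eds_metric f p u V =
    (ddir (\<lambda>q. fst (V q)) p u + 1 / 3 * \<tau> p powr (- (1 / 3)) * (ddir \<xi> p u \<bullet> snd (V p)),
     ddir (\<lambda>q. snd (V q)) p u +
       (1 / 3 * \<tau> p powr (- 1)) *\<^sub>R (ddir \<tau> p u *\<^sub>R snd (V p) + fst (V p) *\<^sub>R ddir \<xi> p u))"
proof -
  have "christoffel eds_metric (f p) (ddir f p u) (V p) =
    (1 / 3 * \<tau> p powr (- (1 / 3)) * (ddir \<xi> p u \<bullet> snd (V p)),
      (1 / 3 * \<tau> p powr (- 1)) *\<^sub>R (ddir \<tau> p u *\<^sub>R snd (V p) + fst (V p) *\<^sub>R ddir \<xi> p u))"
    using christoffel_eds[OF time_pos[OF p], of "\<xi> p" "ddir f p u" "V p"] time_pos[OF p]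
    by (simp add: eds_powr(3)[OF time_pos[OF p]] ddir_f[OF p])
  moreover have "ddir V p u = (ddir (\<lambda>q. fst (V q)) p u, ddir (\<lambda>q. snd (V q)) p u)"
    using ddir_fst[OF V p, of u] ddir_snd[OF V p, of u] by simp
  ultimately show ?thesis by (simp add: cov_along_def)
qed

lemma smooth_time_powr: "smooth_on S (\<lambda>p. \<tau> p powr c)"
  by (rule smooth_on_powr[OF open_S smooth_time time_pos])

lemma
  assumes V: "smooth_on S V"
  shows smooth_fst: "smooth_on S (\<lambda>q. fst (V q))" and smooth_snd: "smooth_on S (\<lambda>q. snd (V q))"
  by (rule smooth_on_fst[OF open_S V], rule smooth_on_snd[OF open_S V])

lemma smooth_cov_eds:
  assumes V: "smooth_on S V"
  shows "smooth_on S (\<lambda>p. cov_along eds_metric f p u V)"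
proof -
  have A: "smooth_on S (\<lambda>p. ddir (\<lambda>q. fst (V q)) p u +
      1 / 3 * \<tau> p powr (- (1 / 3)) * (ddir \<xi> p u \<bullet> snd (V p)))"
    and B: "smooth_on S (\<lambda>p. ddir (\<lambda>q. snd (V q)) p u +
      (1 / 3 * \<tau> p powr (- 1)) *\<^sub>R (ddir \<tau> p u *\<^sub>R snd (V p) + fst (V p) *\<^sub>R ddir \<xi> p u))"
    by (intro smooth_on_add[OF open_S] smooth_on_mult[OF open_S] smooth_on_scaleR[OF open_S]
        smooth_on_inner[OF open_S] smooth_on_const smooth_on_ddir smooth_time smooth_space
        smooth_time_powr smooth_fst[OF V] smooth_snd[OF V])+
  show ?thesis
    using smooth_on_cong[OF open_S cov_along_eds[OF _ V]] smooth_on_Pair[OF open_S A B] by simp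
qed

lemma eds_metric_compatible:
  assumes p: "p \<in> S" and V: "smooth_on S V" and W: "smooth_on S W"
  shows "ddir (\<lambda>q. eds_metric (f q) (V q) (W q)) p u =
    eds_metric (f p) (cov_along eds_metric f p u V) (W p) +
    eds_metric (f p) (V p) (cov_along eds_metric f p u W)"
proof -
  note t = time_pos[OF p]
  note sm = smooth_fst[OF V] smooth_snd[OF V] smooth_fst[OF W] smooth_snd[OF W]
  have smi: "smooth_on S (\<lambda>q. snd (V q) \<bullet> snd (W q))" by (intro smooth_on_inner[OF open_S] sm)
  have smm: "smooth_on S (\<lambda>q. fst (V q) * fst (W q))" by (intro smooth_on_mult[OF open_S] sm)
  have "ddir (\<lambda>q. eds_metric (f q) (V q) (W q)) p u =
      ddir (\<lambda>q. - (fst (V q) * fst (W q)) + \<tau> q powr (2 / 3) * (snd (V q) \<bullet> snd (W q))) p u"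
    using ddir_cong_open[OF open_S p, of "\<lambda>q. eds_metric (f q) (V q) (W q)"] metric_eq by simp
  also have "\<dots> = - (fst (V p) * ddir (\<lambda>q. fst (W q)) p u + ddir (\<lambda>q. fst (V q)) p u * fst (W p)) +
      (\<tau> p powr (2 / 3) * (snd (V p) \<bullet> ddir (\<lambda>q. snd (W q)) p u + ddir (\<lambda>q. snd (V q)) p u \<bullet> snd (W p)) +
       (2 / 3 * \<tau> p powr (- (1 / 3)) * ddir \<tau> p u) * (snd (V p) \<bullet> snd (W p)))"
    unfolding ddir_add[OF smooth_on_minus[OF open_S smm] smooth_on_mult[OF open_S smooth_time_powr smi] p]
      ddir_bounded_linear[OF bounded_linear_minus[OF bounded_linear_ident] smm p]
      ddir_mult[OF sm(1,3) p] ddir_mult[OF smooth_time_powr smi p] ddir_inner[OF sm(2,4) p]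
      ddir_powr[OF smooth_time p t] by simp
  also have "\<dots> = eds_metric (f p) (cov_along eds_metric f p u V) (W p) +
    eds_metric (f p) (V p) (cov_along eds_metric f p u W)"
    using t unfolding metric_eq[OF p] cov_along_eds[OF p V] cov_along_eds[OF p W] eds_powr[OF t]
    by (simp add: inner_add_left inner_add_right inner_commute field_simps)
  finally show ?thesis .
qed

sublocale spacelike_immersion eds_metric f S
proof (rule spacelike_immersion.intro)
  show "open S" by (rule open_S)
  show "smooth_on S f" by (rule smooth_f)
  show "bilinear (eds_metric (f p))" for p by (rule bilinear_eds_metric)
  show "eds_metric (f p) X Y = eds_metric (f p) Y X" for p X Y by (rule eds_metric_sym)
  show "0 < eds_metric (f p) (ddir f p v) (ddir f p v)" if "p \<in> S" "v \<noteq> 0" for p v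
    using pos_def[OF that] by (simp add: induced_metric_def)
  show "smooth_on S (\<lambda>p. eds_metric (f p) (V p) (W p))" if V: "smooth_on S V" and W: "smooth_on S W" for V W
  proof -
    have "smooth_on S (\<lambda>q. - (fst (V q) * fst (W q)) + \<tau> q powr (2 / 3) * (snd (V q) \<bullet> snd (W q)))"
      by (intro smooth_on_add[OF open_S] smooth_on_minus[OF open_S] smooth_on_mult[OF open_S]
          smooth_on_inner[OF open_S] smooth_time_powr smooth_fst[OF V] smooth_snd[OF V]
          smooth_fst[OF W] smooth_snd[OF W])
    then show ?thesis
      using smooth_on_cong[OF open_S, of "\<lambda>p. eds_metric (f p) (V p) (W p)"] metric_eq by simp
  qed
  show "smooth_on S (\<lambda>p. cov_along eds_metric f p u V)" if "smooth_on S V" for u V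
    by (rule smooth_cov_eds[OF that])
  show "linear (\<lambda>u. cov_along eds_metric f p u V)" if p: "p \<in> S" and V: "smooth_on S V" for p V
    using linear_add[OF linear_ddir[OF smooth_time p]] linear_add[OF linear_ddir[OF smooth_space p]]
      linear_add[OF linear_ddir[OF smooth_fst[OF V] p]] linear_add[OF linear_ddir[OF smooth_snd[OF V] p]]
      linear_cmul[OF linear_ddir[OF smooth_time p]] linear_cmul[OF linear_ddir[OF smooth_space p]]
      linear_cmul[OF linear_ddir[OF smooth_fst[OF V] p]] linear_cmul[OF linear_ddir[OF smooth_snd[OF V] p]]
    by (intro linearI) (simp_all add: cov_along_eds[OF p V] inner_add_left algebra_simps)
  show "ddir (\<lambda>q. eds_metric (f q) (V q) (W q)) p u =
    eds_metric (f p) (cov_along eds_metric f p u V) (W p) +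
    eds_metric (f p) (V p) (cov_along eds_metric f p u W)"
    if "p \<in> S" "smooth_on S V" "smooth_on S W" for p u V W
    by (rule eds_metric_compatible[OF that])
  show "cov_along eds_metric f p u (\<lambda>q. ddir f q v) = cov_along eds_metric f p v (\<lambda>q. ddir f q u)"
    if p: "p \<in> S" for p u v
  proof -
    have "christoffel eds_metric (f p) (ddir f p u) (ddir f p v) =
        christoffel eds_metric (f p) (ddir f p v) (ddir f p u)"
      using christoffel_eds[OF time_pos[OF p], of "\<xi> p"] by (simp add: inner_commute add.commute)
    then show ?thesis using ddir_commute[OF open_S smooth_f p, of v u] by (simp add: cov_along_def)
  qed
qed

text \<open>The curvature of the Einstein-de Sitter connection along \<open>f\<close>. Its Christoffel symbols are
  \<open>m = a a'\<close> and \<open>k = a' / a\<close> with \<open>a = t powr (1 / 3)\<close>. All second derivatives of \<open>f\<close> and \<open>V\<close> cancel by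
  symmetry, and the coefficients that survive are \<open>m' - m k = a a''\<close>, \<open>k' + k\<^sup>2 = a'' / a\<close> and \<open>k m = a'\<^sup>2\<close>.\<close>

lemma second_cov_eds:
  assumes p: "p \<in> S" and V: "smooth_on S V"
  defines "\<rho> \<equiv> \<tau> p powr (- (1 / 3))" and "\<sigma> \<equiv> 1 / \<tau> p"
  shows "fst (nabla p u (\<lambda>q. nabla q v V)) - fst (nabla p v (\<lambda>q. nabla q u V)) =
      - (2 / 9) * \<rho> * \<sigma> * (ddir \<tau> p u * (ddir \<xi> p v \<bullet> snd (V p)) - ddir \<tau> p v * (ddir \<xi> p u \<bullet> snd (V p)))"
    and "snd (nabla p u (\<lambda>q. nabla q v V)) - snd (nabla p v (\<lambda>q. nabla q u V)) =
      (- (2 / 9) * \<sigma> * \<sigma> * fst (V p)) *\<^sub>R (ddir \<tau> p u *\<^sub>R ddir \<xi> p v - ddir \<tau> p v *\<^sub>R ddir \<xi> p u) +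
      (\<rho> * \<sigma> / 9) *\<^sub>R ((ddir \<xi> p v \<bullet> snd (V p)) *\<^sub>R ddir \<xi> p u - (ddir \<xi> p u \<bullet> snd (V p)) *\<^sub>R ddir \<xi> p v)"
proof -
  note t = time_pos[OF p]
  define V0 where "V0 = (\<lambda>q. fst (V q))"
  define V1 where "V1 = (\<lambda>q. snd (V q))"
  have sm: "smooth_on S V0" "smooth_on S V1" unfolding V0_def V1_def by (rule smooth_fst[OF V] smooth_snd[OF V])+
  define k where "k = (\<lambda>q. 1 / 3 * \<tau> q powr (- 1))"
  define m where "m = (\<lambda>q. 1 / 3 * \<tau> q powr (- (1 / 3)))"
  have smk: "smooth_on S k" and smm: "smooth_on S m"
    unfolding k_def m_def by (intro smooth_on_mult[OF open_S] smooth_on_const smooth_time_powr)+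
  have Dk: "ddir k p u = - (1 / 3) * \<sigma> * \<sigma> * ddir \<tau> p u" for u
    unfolding k_def ddir_bounded_linear[OF bounded_linear_mult_right smooth_time_powr p]
      ddir_powr[OF smooth_time p t] using t by (simp add: eds_powr[OF t] \<sigma>_def)
  have Dm: "ddir m p u = - (1 / 9) * \<rho> * \<sigma> * ddir \<tau> p u" for u
    unfolding m_def ddir_bounded_linear[OF bounded_linear_mult_right smooth_time_powr p]
    by (simp add: ddir_powr[OF smooth_time p t] eds_powr[OF t] \<rho>_def \<sigma>_def)
  define A0 where "A0 = (\<lambda>v q. ddir V0 q v + m q * (ddir \<xi> q v \<bullet> V1 q))"
  define A1 where "A1 = (\<lambda>v q. ddir V1 q v + k q *\<^sub>R (ddir \<tau> q v *\<^sub>R V1 q + V0 q *\<^sub>R ddir \<xi> q v))"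
  have nab: "nabla q v V = (A0 v q, A1 v q)" if "q \<in> S" for q v
    unfolding cov_along_eds[OF that V] A0_def A1_def V0_def V1_def m_def k_def by simp
  note smd = smooth_on_ddir[OF smooth_time] smooth_on_ddir[OF smooth_space] smooth_on_ddir[OF sm(1)] smooth_on_ddir[OF sm(2)]
  note smi = smooth_on_inner[OF open_S smd(2) sm(2)]
  note sms = smooth_on_scaleR[OF open_S smd(1) sm(2)] smooth_on_scaleR[OF open_S sm(1) smd(2)]
  have smA: "smooth_on S (A0 v)" "smooth_on S (A1 v)" for v
    unfolding A0_def A1_def
    by (intro smooth_on_add[OF open_S] smooth_on_mult[OF open_S] smooth_on_scaleR[OF open_S]
        smooth_on_inner[OF open_S] smd sm smk smm)+
  have smA': "smooth_on S (\<lambda>q. (A0 v q, A1 v q))" for v by (rule smooth_on_Pair[OF open_S smA])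
  have DA0: "ddir (A0 v) p u = ddir (\<lambda>q. ddir V0 q v) p u +
      (m p * (ddir \<xi> p v \<bullet> ddir V1 p u + ddir (\<lambda>q. ddir \<xi> q v) p u \<bullet> V1 p) + ddir m p u * (ddir \<xi> p v \<bullet> V1 p))"
    for u v
    unfolding A0_def ddir_add[OF smd(3) smooth_on_mult[OF open_S smm smi] p] ddir_mult[OF smm smi p]
      ddir_inner[OF smd(2) sm(2) p] by (rule refl)
  have DA1: "ddir (A1 v) p u = ddir (\<lambda>q. ddir V1 q v) p u +
      (k p *\<^sub>R ((ddir \<tau> p v *\<^sub>R ddir V1 p u + ddir (\<lambda>q. ddir \<tau> q v) p u *\<^sub>R V1 p) +
         (V0 p *\<^sub>R ddir (\<lambda>q. ddir \<xi> q v) p u + ddir V0 p u *\<^sub>R ddir \<xi> p v)) +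
       ddir k p u *\<^sub>R (ddir \<tau> p v *\<^sub>R V1 p + V0 p *\<^sub>R ddir \<xi> p v))" for u v
    unfolding A1_def ddir_add[OF smd(4) smooth_on_scaleR[OF open_S smk smooth_on_add[OF open_S sms]] p]
      ddir_scaleR[OF smk smooth_on_add[OF open_S sms] p] ddir_add[OF sms p]
      ddir_scaleR[OF smd(1) sm(2) p] ddir_scaleR[OF sm(1) smd(2) p] by (rule refl)
  have nabnab: "nabla p u (\<lambda>q. nabla q v V) =
      (ddir (A0 v) p u + m p * (ddir \<xi> p u \<bullet> A1 v p),
       ddir (A1 v) p u + k p *\<^sub>R (ddir \<tau> p u *\<^sub>R A1 v p + A0 v p *\<^sub>R ddir \<xi> p u))" for u v
    using cov_cong[OF p, of "\<lambda>q. nabla q v V" "\<lambda>q. (A0 v q, A1 v q)"] nab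
      cov_along_eds[OF p smA'] by (simp add: m_def k_def)
  note comm = ddir_commute[OF open_S smooth_time p, of v u] ddir_commute[OF open_S smooth_space p, of v u]
    ddir_commute[OF open_S sm(1) p, of v u] ddir_commute[OF open_S sm(2) p, of v u]
  have kp: "k p = \<sigma> / 3" and mp: "m p = \<rho> / 3"
    using t by (simp_all add: k_def m_def \<rho>_def \<sigma>_def eds_powr[OF t])
  have V01: "fst (V p) = V0 p" "snd (V p) = V1 p" by (simp_all add: V0_def V1_def)
  have a: "A0 v p = ddir V0 p v + m p * (ddir \<xi> p v \<bullet> V1 p)"
    "A1 v p = ddir V1 p v + k p *\<^sub>R (ddir \<tau> p v *\<^sub>R V1 p + V0 p *\<^sub>R ddir \<xi> p v)" for v
    by (simp_all add: A0_def A1_def)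
  show "fst (nabla p u (\<lambda>q. nabla q v V)) - fst (nabla p v (\<lambda>q. nabla q u V)) =
      - (2 / 9) * \<rho> * \<sigma> * (ddir \<tau> p u * (ddir \<xi> p v \<bullet> snd (V p)) - ddir \<tau> p v * (ddir \<xi> p u \<bullet> snd (V p)))"
    unfolding nabnab fst_conv DA0 Dm a V01 mp comm kp
    by (simp add: inner_add_left inner_add_right inner_commute[of "ddir \<xi> p v" "ddir \<xi> p u"] algebra_simps)
  show "snd (nabla p u (\<lambda>q. nabla q v V)) - snd (nabla p v (\<lambda>q. nabla q u V)) =
      (- (2 / 9) * \<sigma> * \<sigma> * fst (V p)) *\<^sub>R (ddir \<tau> p u *\<^sub>R ddir \<xi> p v - ddir \<tau> p v *\<^sub>R ddir \<xi> p u) +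
      (\<rho> * \<sigma> / 9) *\<^sub>R ((ddir \<xi> p v \<bullet> snd (V p)) *\<^sub>R ddir \<xi> p u - (ddir \<xi> p u \<bullet> snd (V p)) *\<^sub>R ddir \<xi> p v)"
    unfolding nabnab snd_conv DA1 Dk a V01 mp comm kp
    by (rule euclidean_eqI) (simp add: inner_add_left inner_diff_left inner_add_right algebra_simps)
qed

lemma metric_ambient_curv:
  assumes p: "p \<in> S"
  defines "\<rho> \<equiv> \<tau> p powr (- (1 / 3))"
  shows "eds_metric (f p) (ambient_curv p u v w) W =
    \<rho> / (9 * \<tau> p) *
     (2 * fst W * (ddir \<tau> p u * (ddir \<xi> p v \<bullet> ddir \<xi> p w) - ddir \<tau> p v * (ddir \<xi> p u \<bullet> ddir \<xi> p w)) -
      2 * ddir \<tau> p w * (ddir \<tau> p u * (ddir \<xi> p v \<bullet> snd W) - ddir \<tau> p v * (ddir \<xi> p u \<bullet> snd W)) +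
      \<tau> p * \<rho> * ((ddir \<xi> p v \<bullet> ddir \<xi> p w) * (ddir \<xi> p u \<bullet> snd W) -
        (ddir \<xi> p u \<bullet> ddir \<xi> p w) * (ddir \<xi> p v \<bullet> snd W)))"
proof -
  define \<sigma> where "\<sigma> = 1 / \<tau> p"
  have t: "\<rho> / (9 * \<tau> p) = \<rho> * \<sigma> / 9" "\<tau> p * \<sigma> = 1" using time_pos[OF p] by (simp_all add: \<sigma>_def)
  have t': "\<sigma> * (2 * (\<tau> p * x)) = 2 * x" for x
  proof -
    have "\<sigma> * (2 * (\<tau> p * x)) = (\<tau> p * \<sigma>) * (2 * x)" by (simp add: mult_ac)
    then show ?thesis using t(2) by simp
  qed
  have F: "fst (ambient_curv p u v w) =
      - (2 / 9) * \<rho> * \<sigma> * (ddir \<tau> p u * (ddir \<xi> p v \<bullet> ddir \<xi> p w) - ddir \<tau> p v * (ddir \<xi> p u \<bullet> ddir \<xi> p w))"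
    using second_cov_eds(1)[OF p smooth_coord, of u v w]
    by (simp add: ambient_curv_def ddir_f[OF p] \<rho>_def \<sigma>_def)
  have G: "snd (ambient_curv p u v w) =
      (- (2 / 9) * \<sigma> * \<sigma> * ddir \<tau> p w) *\<^sub>R (ddir \<tau> p u *\<^sub>R ddir \<xi> p v - ddir \<tau> p v *\<^sub>R ddir \<xi> p u) +
      (\<rho> * \<sigma> / 9) *\<^sub>R ((ddir \<xi> p v \<bullet> ddir \<xi> p w) *\<^sub>R ddir \<xi> p u - (ddir \<xi> p u \<bullet> ddir \<xi> p w) *\<^sub>R ddir \<xi> p v)"
    using second_cov_eds(2)[OF p smooth_coord, of u v w]
    by (simp add: ambient_curv_def ddir_f[OF p] \<rho>_def \<sigma>_def)
  show ?thesis
    unfolding metric_eq[OF p] F G t(1) eds_powr(1)[OF time_pos[OF p]]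
    unfolding \<rho>_def[symmetric]
    by (simp add: inner_add_left inner_diff_left algebra_simps t')
qed

lemma h_eq:
  "p \<in> S \<Longrightarrow> h p u v = - (ddir \<tau> p u * ddir \<tau> p v) + \<tau> p powr (2 / 3) * (ddir \<xi> p u \<bullet> ddir \<xi> p v)"
  by (simp add: induced_metric_def metric_eq ddir_f)

text \<open>The normal part of the observer field \<open>\<partial>\<^sub>t\<close>: since \<open>\<partial>\<^sub>t\<close> is timelike and its tangential part is spacelike,
  what remains is timelike.\<close>

lemma timelike_normal:
  assumes p: "p \<in> S"
  obtains N where "normal p N" "eds_metric (f p) N N < 0" "0 < fst N"
proof -
  define T :: "real \<times> (real ^ 'n)" where "T = (1, 0)"
  define N where "N = normal_part eds_metric f p T"
  define y where "y = tangent_coord p T"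
  have N: "normal p N" unfolding N_def using normal_normal_part[OF p] by blast
  have T: "T = N + ddir f p y" by (simp add: N_def y_def normal_part_eq[OF p])
  have "eds_metric (f p) T T = eds_metric (f p) N N + h p y y"
    unfolding T bilinear_ladd[OF bilinear_eds_metric] bilinear_radd[OF bilinear_eds_metric]
    using N eds_metric_sym[of "f p" "ddir f p y" N] by (simp add: induced_metric_def)
  moreover have "0 \<le> h p y y"
    using h_pos[OF p, of y] by (cases "y = 0") (auto simp: bilinear_lzero[OF bilinear_h[OF p]] less_imp_le)
  ultimately have NN: "eds_metric (f p) N N < 0" by (simp add: metric_eq[OF p] T_def)
  have "eds_metric (f p) N N = eds_metric (f p) T N"
    using metric_normal_part[OF p N, of T] by (simp add: N_def)
  then have "eds_metric (f p) N N = - fst N" by (simp add: metric_eq[OF p] T_def)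
  then show ?thesis using that[OF N NN] NN by simp
qed

text \<open>A tangent vector with vanishing space part would have nonpositive square.\<close>

lemma space_part_surj:
  assumes p: "p \<in> S"
  obtains z where "ddir \<xi> p z = y"
proof -
  have lin: "linear (ddir \<xi> p)" by (rule linear_ddir[OF smooth_space p])
  have "z = 0" if "ddir \<xi> p z = 0" for z
  proof (rule ccontr)
    assume "z \<noteq> 0"
    then have "0 < h p z z" by (rule h_pos[OF p])
    then show False using that by (simp add: h_eq[OF p] not_less)
  qed
  then have "inj (ddir \<xi> p)" using lin linear_injective_0 by blast
  then have "surj (ddir \<xi> p)" by (rule linear_injective_imp_surjective[OF lin]) simp
  then show ?thesis using that by (metis surj_def)
qed

lemma normal_eq_0:
  assumes p: "p \<in> S" and X: "normal p X" and 0: "fst X = 0"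
  shows "X = 0"
proof -
  obtain z where z: "ddir \<xi> p z = snd X" using space_part_surj[OF p] by blast
  have "eds_metric (f p) X (ddir f p z) = 0" using X by blast
  then have "snd X = 0" using time_pos[OF p] by (simp add: metric_eq[OF p] ddir_f[OF p] 0 z)
  then show ?thesis using 0 by (simp add: prod_eq_iff)
qed

text \<open>Codimension one: subtracting a multiple of \<open>N\<close> removes the time component of a normal vector, and a
  normal vector without time component is orthogonal to all space directions.\<close>

lemma normal_eq_scaleR:
  assumes p: "p \<in> S" and X: "normal p X" and N: "normal p N" "0 < fst N"
  shows "X = (fst X / fst N) *\<^sub>R N"
proof -
  let ?Y = "X - (fst X / fst N) *\<^sub>R N"
  have "normal p ?Y"
    using X N(1) by (simp add: bilinear_lsub[OF bilinear_eds_metric] bilinear_lmul[OF bilinear_eds_metric])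
  moreover have "fst ?Y = 0" using N(2) by simp
  ultimately have "?Y = 0" by (rule normal_eq_0[OF p])
  then show ?thesis by simp
qed

text \<open>On a plane spanned by \<open>X, Y\<close> the curvature is a positive multiple of
  \<open>2 |dt(X) Y - dt(Y) X|\<^sup>2\<close>, taken on the space parts, plus a positive multiple of their Gram determinant.\<close>

lemma ambient_sectional_nonneg:
  assumes p: "p \<in> S"
  shows "0 \<le> eds_metric (f p) (ambient_curv p u v v) (ddir f p u)"
proof -
  define X Y x y where "X = ddir \<xi> p u" and "Y = ddir \<xi> p v" and "x = ddir \<tau> p u" and "y = ddir \<tau> p v"
  define \<rho> where "\<rho> = \<tau> p powr (- (1 / 3))"
  have \<rho>: "0 < \<rho>" using time_pos[OF p] by (simp add: \<rho>_def)
  have "2 * x * (x * (Y \<bullet> Y) - y * (X \<bullet> Y)) - 2 * y * (x * (Y \<bullet> X) - y * (X \<bullet> X)) =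
      2 * ((x *\<^sub>R Y - y *\<^sub>R X) \<bullet> (x *\<^sub>R Y - y *\<^sub>R X))"
    by (simp add: inner_diff_left inner_diff_right inner_commute algebra_simps)
  moreover have "0 \<le> (Y \<bullet> Y) * (X \<bullet> X) - (X \<bullet> Y) * (Y \<bullet> X)"
    using Cauchy_Schwarz_ineq[of X Y] by (simp add: inner_commute power2_eq_square mult.commute)
  then have "0 \<le> \<tau> p * \<rho> * ((Y \<bullet> Y) * (X \<bullet> X) - (X \<bullet> Y) * (Y \<bullet> X))"
    using time_pos[OF p] \<rho> by simp
  ultimately have "0 \<le> 2 * x * (x * (Y \<bullet> Y) - y * (X \<bullet> Y)) - 2 * y * (x * (Y \<bullet> X) - y * (X \<bullet> X)) +
      \<tau> p * \<rho> * ((Y \<bullet> Y) * (X \<bullet> X) - (X \<bullet> Y) * (Y \<bullet> X))"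
    by simp
  then have "0 \<le> \<rho> / (9 * \<tau> p) * (2 * x * (x * (Y \<bullet> Y) - y * (X \<bullet> Y)) - 2 * y * (x * (Y \<bullet> X) - y * (X \<bullet> X)) +
      \<tau> p * \<rho> * ((Y \<bullet> Y) * (X \<bullet> X) - (X \<bullet> Y) * (Y \<bullet> X)))"
    using time_pos[OF p] \<rho> by (intro mult_nonneg_nonneg) simp_all
  then show ?thesis
    unfolding metric_ambient_curv[OF p] ddir_f[OF p] fst_conv snd_conv X_def Y_def x_def y_def \<rho>_def .
qed

lemma riemann_skew:
  assumes p: "p \<in> S"
  shows "h p (riemann h p u v w) z = - h p (riemann h p u v z) w"
  unfolding Gauss_equation[OF p] metric_ambient_curv[OF p] ddir_f[OF p] fst_conv snd_conv
  by (simp add: eds_metric_sym[of "f p" "second_ff eds_metric f p v w"]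
      eds_metric_sym[of "f p" "second_ff eds_metric f p u w"] inner_commute algebra_simps)

text \<open>Otherwise the plane of two eigenvectors with eigenvalues of opposite sign would have vanishing
  sectional curvature, whereas the Gauss equation makes it positive.\<close>

lemma extremal_semi_parallel_imp_totally_geodesic:
  assumes p: "p \<in> S" and ext: "mean_curvature eds_metric f p = 0"
    and sp: "\<And>x y z w. curv_dot_sff eds_metric f p x y z w = 0"
  shows "second_ff eds_metric f p u v = 0"
proof (rule ccontr)
  assume nz: "second_ff eds_metric f p u v \<noteq> 0"
  obtain N where N: "normal p N" "eds_metric (f p) N N < 0" "0 < fst N" using timelike_normal[OF p] .
  define A where "A = (\<lambda>u v. fst (second_ff eds_metric f p u v) / fst N)"
  have sff: "second_ff eds_metric f p u v = A u v *\<^sub>R N" for u v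
    unfolding A_def using normal_second_ff[OF p] by (intro normal_eq_scaleR[OF p _ N(1,3)]) blast
  have A_bil: "bilinear A"
    unfolding bilinear_def A_def
    by (auto intro!: linearI simp: add_divide_distrib linear_add[OF linear_second_ff(1)[OF p]]
        linear_cmul[OF linear_second_ff(1)[OF p]] linear_add[OF linear_second_ff(2)[OF p]]
        linear_cmul[OF linear_second_ff(2)[OF p]])
  have A_sym: "A u v = A v u" for u v by (simp add: A_def second_ff_sym[OF p, of u v])
  have hp: "bilinear (h p)" "\<And>u v. h p u v = h p v u" "\<And>v. v \<noteq> 0 \<Longrightarrow> 0 < h p v v"
    using bilinear_h[OF p] h_sym[OF p] h_pos[OF p] by blast+
  have trace: "(\<Sum>i\<in>UNIV. \<Sum>j\<in>UNIV.
      matrix_inv (\<chi> i j. h p (axis i 1) (axis j 1)) $ i $ j * A (axis i 1) (axis j 1)) = 0"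
  proof -
    have "(\<Sum>i\<in>UNIV. \<Sum>j\<in>UNIV. matrix_inv (\<chi> i j. h p (axis i 1) (axis j 1)) $ i $ j *\<^sub>R
        second_ff eds_metric f p (axis i 1) (axis j 1)) = 0"
      using ext by (simp add: mean_curvature_def Let_def)
    then have "(\<Sum>i\<in>UNIV. \<Sum>j\<in>UNIV. matrix_inv (\<chi> i j. h p (axis i 1) (axis j 1)) $ i $ j *
        A (axis i 1) (axis j 1)) *\<^sub>R N = 0"
      by (simp add: sff scaleR_sum_left)
    moreover have "N \<noteq> 0" using N(3) by auto
    ultimately show ?thesis by (simp only: scaleR_eq_0_iff) blast
  qed
  have "A u v \<noteq> 0" using nz by (auto simp: sff)
  then obtain e d l m where ed: "e \<noteq> 0" "d \<noteq> 0" "0 < l" "m < 0" "\<And>v. A e v = l * h p e v"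
    "\<And>v. A d v = m * h p d v" "h p e d = 0"
    using traceless_form_eigenvectors[OF A_bil A_sym hp trace] by metis
  have comm: "A (riemann h p e d z) z * A z z = 0" for z
    using semi_parallel_second_ff[OF p sp, of e d z] N(2)
    by (auto simp: sff bilinear_lmul[OF bilinear_eds_metric] bilinear_rmul[OF bilinear_eds_metric])
  have "h p (riemann h p e d d) e = 0"
  proof (rule skew_commuting_eigenvectors[where R = "riemann h p e d"])
    show "bilinear A" "\<And>u v. A u v = A v u" by (rule A_bil, rule A_sym)
    show "bilinear (h p)" "\<And>u v. h p u v = h p v u" "0 < h p d d" by (rule hp(1), rule hp(2), rule hp(3)[OF ed(2)])
    show "\<And>v. A e v = l * h p e v" "\<And>v. A d v = m * h p d v" "h p e d = 0" "0 < l" "m < 0" by (rule ed)+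
    show "h p (riemann h p e d w) z = - h p (riemann h p e d z) w" for w z by (rule riemann_skew[OF p])
    show "A (riemann h p e d z) z * A z z = 0" for z by (rule comm)
  qed
  moreover have "h p (riemann h p e d d) e =
      eds_metric (f p) (ambient_curv p e d d) (ddir f p e) + A d d * A e e * eds_metric (f p) N N"
    unfolding Gauss_equation[OF p] sff
    by (simp add: bilinear_lmul[OF bilinear_eds_metric] bilinear_rmul[OF bilinear_eds_metric]
        bilinear_lzero[OF bilinear_eds_metric] ed(5,7))
  moreover have "0 < A d d * A e e * eds_metric (f p) N N"
    using ed(3,4) hp(3)[OF ed(1)] hp(3)[OF ed(2)] N(2)
    by (simp add: ed(5,6) zero_less_mult_iff mult_less_0_iff)
  ultimately show False using ambient_sectional_nonneg[OF p, of e d] by linarith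
qed

lemma orthogonal_vector_exists:
  assumes p: "p \<in> S" and n: "CARD('n) \<ge> 2"
  obtains v where "v \<noteq> 0" "h p u v = 0"
proof -
  obtain i j :: 'n where ij: "i \<noteq> j"
    using n card_le_Suc0_iff_eq[of "UNIV :: 'n set"] by fastforce
  \<comment> \<open>this combination of two axes is always orthogonal to \<open>u\<close>, but may be zero\<close>
  let ?v = "h p u (axis j 1) *\<^sub>R axis i 1 - h p u (axis i 1) *\<^sub>R axis j (1::real)"
  show ?thesis
  proof (cases "h p u (axis i 1) = 0")
    case True
    then show ?thesis using that[of "axis i 1"] by (simp add: axis_eq_0_iff)
  next
    case False
    have "?v $ j = - h p u (axis i 1)" using ij by (simp add: axis_def)
    then have "?v \<noteq> 0" using False by (metis neg_equal_0_iff_equal zero_index)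
    moreover have "h p u ?v = 0"
      by (simp add: bilinear_rsub[OF bilinear_h[OF p]] bilinear_rmul[OF bilinear_h[OF p]])
    ultimately show ?thesis using that by blast
  qed
qed

text \<open>For tangent vectors \<open>X, Y, Z\<close> and normal \<open>N\<close>, the ambient curvature pairs \<open>R(X, Y)Z\<close> with \<open>N\<close> to a nonzero
  multiple of \<open>dt(X) h(Y, Z) - dt(Y) h(X, Z)\<close>. It is evaluated at \<open>Y = Z\<close> orthogonal to \<open>X\<close>.\<close>

lemma totally_geodesic_imp_time_constant:
  assumes p: "p \<in> S" and n: "CARD('n) \<ge> 2"
    and tg: "\<And>q u v. q \<in> S \<Longrightarrow> second_ff eds_metric f q u v = 0"
  shows "ddir \<tau> p u = 0"
proof -
  obtain N where N: "normal p N" "0 < fst N" using timelike_normal[OF p] by blast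
  obtain v where v: "v \<noteq> 0" "h p u v = 0" using orthogonal_vector_exists[OF p n] by blast
  define \<rho> where "\<rho> = \<tau> p powr (- (1 / 3))"
  define s where "s = (\<lambda>x y :: real ^ 'n. \<tau> p * \<rho> * (x \<bullet> y))"
  have pos: "0 < \<tau> p" "0 < \<rho>" using time_pos[OF p] by (simp_all add: \<rho>_def)
  have sN: "s (ddir \<xi> p w) (snd N) = ddir \<tau> p w * fst N" for w
    using N(1)[rule_format, of w] pos
    by (simp add: metric_eq[OF p] ddir_f[OF p] s_def \<rho>_def eds_powr(1)[OF time_pos[OF p]] inner_commute mult.commute)
  have sh: "s (ddir \<xi> p u) (ddir \<xi> p w) = h p u w + ddir \<tau> p u * ddir \<tau> p w" for u w
    by (simp add: h_eq[OF p] s_def \<rho>_def eds_powr(1)[OF time_pos[OF p]])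
  have "eds_metric (f p) (ambient_curv p u v v) N = 0"
    by (rule totally_geodesic_ambient_curv[OF p tg N(1)])
  then have *: "2 * fst N * (ddir \<tau> p u * (ddir \<xi> p v \<bullet> ddir \<xi> p v) - ddir \<tau> p v * (ddir \<xi> p u \<bullet> ddir \<xi> p v)) -
      2 * ddir \<tau> p v * (ddir \<tau> p u * (ddir \<xi> p v \<bullet> snd N) - ddir \<tau> p v * (ddir \<xi> p u \<bullet> snd N)) +
      \<tau> p * \<rho> * ((ddir \<xi> p v \<bullet> ddir \<xi> p v) * (ddir \<xi> p u \<bullet> snd N) -
        (ddir \<xi> p u \<bullet> ddir \<xi> p v) * (ddir \<xi> p v \<bullet> snd N)) = 0"
    using pos unfolding metric_ambient_curv[OF p] \<rho>_def[symmetric] by simp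
  \<comment> \<open>multiplying by \<open>a\<^sup>2 = \<tau> \<rho>\<close> turns Euclidean products of space parts into \<open>s\<close>, which differs from
    the metric only by the product of the time components\<close>
  have "\<tau> p * \<rho> * (2 * fst N * (ddir \<tau> p u * (ddir \<xi> p v \<bullet> ddir \<xi> p v) - ddir \<tau> p v * (ddir \<xi> p u \<bullet> ddir \<xi> p v)) -
      2 * ddir \<tau> p v * (ddir \<tau> p u * (ddir \<xi> p v \<bullet> snd N) - ddir \<tau> p v * (ddir \<xi> p u \<bullet> snd N)) +
      \<tau> p * \<rho> * ((ddir \<xi> p v \<bullet> ddir \<xi> p v) * (ddir \<xi> p u \<bullet> snd N) -
        (ddir \<xi> p u \<bullet> ddir \<xi> p v) * (ddir \<xi> p v \<bullet> snd N))) =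
    2 * fst N * (ddir \<tau> p u * s (ddir \<xi> p v) (ddir \<xi> p v) - ddir \<tau> p v * s (ddir \<xi> p u) (ddir \<xi> p v)) -
      2 * ddir \<tau> p v * (ddir \<tau> p u * s (ddir \<xi> p v) (snd N) - ddir \<tau> p v * s (ddir \<xi> p u) (snd N)) +
      (s (ddir \<xi> p v) (ddir \<xi> p v) * s (ddir \<xi> p u) (snd N) - s (ddir \<xi> p u) (ddir \<xi> p v) * s (ddir \<xi> p v) (snd N))"
    by (simp add: s_def algebra_simps)
  also have "\<dots> = 3 * fst N * (ddir \<tau> p u * h p v v)"
    unfolding sN sh v(2) by (simp add: algebra_simps)
  finally have "3 * fst N * (ddir \<tau> p u * h p v v) = 0" unfolding * by simp
  then show ?thesis using N(2) h_pos[OF p v(1)] by simp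
qed

text \<open>On a hypersurface of constant time the vector \<open>\<nabla>\<^sub>u f\<^sub>u\<close> has time component
  \<open>a a' |f\<^sub>u|\<^sup>2 > 0\<close>, with the Euclidean norm of the space part, so it is not tangent.\<close>

lemma not_totally_geodesic:
  assumes p: "p \<in> S" and n: "CARD('n) \<ge> 2"
  shows "\<exists>q\<in>S. \<exists>u v. second_ff eds_metric f q u v \<noteq> 0"
proof (rule ccontr)
  assume "\<not> ?thesis"
  then have tg: "second_ff eds_metric f q u v = 0" if "q \<in> S" for q u v using that by blast
  have D: "ddir \<tau> q u = 0" if "q \<in> S" for q u
    by (rule totally_geodesic_imp_time_constant[OF that n tg])
  obtain u :: "real ^ 'n" where u: "u \<noteq> 0" using axis_eq_0_iff[of _ "1::real"] by (metis one_neq_zero)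
  have "nabla p u (coord u) = ddir f p (christoffel h p u u)"
    using second_ff_eq[OF p] tg[OF p] by simp
  then have "fst (nabla p u (coord u)) = 0" by (simp add: ddir_f[OF p] D[OF p])
  moreover have "ddir (\<lambda>q. fst (ddir f q u)) p u = 0"
    using ddir_cong_open[OF open_S p, of "\<lambda>q. fst (ddir f q u)" "\<lambda>_. 0"] by (simp add: ddir_f D)
  ultimately have "ddir \<xi> p u \<bullet> ddir \<xi> p u = 0"
    using time_pos[OF p] unfolding cov_along_eds[OF p smooth_coord] by (simp add: ddir_f[OF p])
  then have "h p u u = 0" by (simp add: h_eq[OF p] D[OF p])
  then show False using h_pos[OF p u] by simp
qed

end

text \<open>All conditions are read in one chart around some point of the nonempty hypersurface: a totally
  geodesic piece, however small, is already impossible.\<close>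

theorem corollary7:
  assumes "CARD('n::finite) \<ge> 2"
  shows "\<not> (\<exists>(M :: 'm topology) (\<A> :: ('m, 'n) chart set) (F :: 'm \<Rightarrow> real \<times> (real ^ 'n)).
            eds_hypersurface M \<A> F \<and> spacelike eds_metric \<A> F \<and>
            extremal eds_metric \<A> F \<and> semi_parallel eds_metric \<A> F)"
proof (rule notI, elim exE conjE)
  fix M :: "'m topology" and \<A> :: "('m, 'n) chart set" and F :: "'m \<Rightarrow> real \<times> (real ^ 'n)"
  assume H: "eds_hypersurface M \<A> F" and sl: "spacelike eds_metric \<A> F"
    and ext: "extremal eds_metric \<A> F" and sp: "semi_parallel eds_metric \<A> F"
  have man: "smooth_manifold M \<A>" and ne: "topspace M \<noteq> {}"
    and FE: "F ` topspace M \<subseteq> eds_spacetime" and imm: "immersion \<A> F"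
    using H by (simp_all add: eds_hypersurface_def)
  have cover: "(\<Union>(U, \<phi>)\<in>\<A>. U) = topspace M" using man by (simp add: smooth_manifold_def)
  obtain U \<phi> x where U: "(U, \<phi>) \<in> \<A>" "x \<in> U" using ne unfolding cover[symmetric] by auto
  have UM: "U \<subseteq> topspace M" using cover U(1) by auto
  have op: "open (\<phi> ` U)" using man U(1) by (auto simp: smooth_manifold_def)
  interpret eds_immersion "F \<circ> inv_into U \<phi>" "\<phi> ` U"
  proof
    show "open (\<phi> ` U)" by (rule op)
    show "smooth_on (\<phi> ` U) (F \<circ> inv_into U \<phi>)" using imm U(1) by (auto simp: immersion_def)
    show "(F \<circ> inv_into U \<phi>) p \<in> eds_spacetime" if "p \<in> \<phi> ` U" for p
      using FE UM inv_into_into[OF that] by auto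
    show "0 < induced_metric eds_metric (F \<circ> inv_into U \<phi>) p v v" if "p \<in> \<phi> ` U" "v \<noteq> 0" for p v
      using sl U(1) that by (auto simp: spacelike_def)
  qed
  have "second_ff eds_metric (F \<circ> inv_into U \<phi>) p u v = 0" if p: "p \<in> \<phi> ` U" for p u v
  proof (rule extremal_semi_parallel_imp_totally_geodesic[OF p])
    show "mean_curvature eds_metric (F \<circ> inv_into U \<phi>) p = 0"
      using ext U(1) p by (auto simp: extremal_def)
    show "curv_dot_sff eds_metric (F \<circ> inv_into U \<phi>) p x y z w = 0" for x y z w
      using sp U(1) p by (auto simp: semi_parallel_def)
  qed
  then show False using not_totally_geodesic[OF imageI[OF U(2)] assms] by blast
qed

end
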